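(* Suppose that $(x_i,\xi_i)$, $i=1,2,\dots$, is an i.i.d. sequence from $\mathcal{D}$ and that the sequence of regularization parameters $\rho_n\in(0,\rho_0]$ satisfies $\lim_{n\to\infty}\rho_n=0$. Suppose Assumptions (1A), (1B), (2A), (2B) listed in the context hold. Then: (i) The optimal empirical regularized risk converges to the optimal expected risk: $\hat J^n_{\rho_n}\to J^*$ with probability 1. (ii) If additionally Assumptions (1C) and (2C) hold, then, $\mathcal{D}_x$-almost surely for all $x\in\mathcal{X}$, the sequence of decisions $w_{\rho_n}(\hat f^n_{\rho_n}(x))$ converges to the true set of optimal decisions $W(f^*(x))$, i.e. $\mathrm{dist}\big(w_{\rho_n}(\hat f^n_{\rho_n}(x)),W(f^*(x))\big)\to 0$ with probability 1. (iii) If additionally Assumptions (1C) and (2C) hold, then the sequence of hypotheses converges to the true hypothesis: $\hat f^n_{\rho_n}\to f^*$ with probability 1.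
   Context: Setting. $S\subset\mathbb{R}^d$ is a nonempty convex compact set and $\|\cdot\|$ is a norm on $\mathbb{R}^d$. The feature vector $x$ takes values in $\mathcal{X}\subseteq\mathbb{R}^p$; the random parameter $\xi$ takes values in a finite set $\Xi=\{\tilde z_1,\dots,\tilde z_K\}$. $\mathcal{D}$ is the joint distribution of $(x,\xi)$ and $\mathcal{D}_x$ the marginal of $x$ (probabilities $\mathbb{P}_x$ and expectations $\mathbb{E}_x$ are with respect to $\mathcal{D}_x$). $c:S\times\Xi\to\mathbb{R}$ is a cost function such that each $c_k(\cdot):=c(\cdot,\tilde z_k)$ is convex and continuous on $S$. $\phi:S\to\mathbb{R}$ is non-negative, continuous and strongly convex with respect to $\|\cdot\|$. $\Delta_K:=\{p\in\mathbb{R}^K:\sum_k p_k=1,\ p\ge 0\}$. For $p\in\Delta_K$ and $\rho>0$, $$W(p):=\arg\min_{w\in S}\sum_{k=1}^K p_kc_k(w),\qquad w_\rho(p):=\arg\min_{w\in S}\Big\{\sum_{k=1}^K p_kc_k(w)+\rho\phi(w)\Big\}$$ (the latter is a single point). $w(\cdot):\Delta_K\to S$ is an arbitrary selection with $w(p)\in W(p)$ for all $p$. $\mathrm{dist}(w,W):=\inf_{u\in W}\|w-u\|$. $\mathcal{H}$ is a hypothesis class of functions $f:\mathcal{X}\to\Delta_K$, compact with respect to the sup-norm metric $\|f-g\|_\infty:=\sup_{x\in\mathcal{X}}|f(x)-g(x)|$ ($|\cdot|$ a fixed norm on $\mathbb{R}^K$). The true hypothesis $f^*$ is $f^*(x)=p^*(x)$,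 with $p^*_k(x):=\mathbb{P}(\xi=\tilde z_k\mid x)$. All functions are assumed measurable so that expectations are defined. Risks. For $\pi:\mathcal{X}\to S$, $R(\pi):=\mathbb{E}_{x,\xi}[c(\pi(x),\xi)]=\mathbb{E}_x[\sum_k p^*_k(x)c_k(\pi(x))]$ and $\hat R_n(\pi):=\frac1n\sum_{i=1}^n c(\pi(x_i),\xi_i)$. Define $J^*:=\min_{f\in\mathcal{H}}R(w\circ f)$; $f^*_\rho$ denotes a minimizer of $R(w_\rho\circ f)$ over $f\in\mathcal{H}$; $\hat J^n_\rho:=\min_{f\in\mathcal{H}}\hat R_n(w_\rho\circ f)$, and $\hat f^n_\rho\in\mathcal{H}$ denotes a minimizer. Multivariate bracketing number. For $l,u:\mathcal{X}\to\mathbb{R}^K$, the bracket $[l,u]$ is the set of $f\in\mathcal{H}$ with $l_k(x)\le f_k(x)\le u_k(x)$ for all $k$ and all $x\in\mathcal{X}$; it is an $\epsilon$-bracket if $\|l-u\|_\infty<\epsilon$. $N_{[]}(\epsilon,\mathcal{H},\|\cdot\|_\infty)$ is the minimum number of $\epsilon$-brackets covering $\mathcal{H}$. Assumptions. (1A) $f^*\in\mathcal{H}$. (1B) $N_{[]}(\epsilon,\mathcal{H},\|\cdot\|_\infty)<\infty$ for every $\epsilon\in(0,1)$. (1C) There is no $f\ne f^*$ in $\mathcal{H}$ such that $W(f(x))\cap W(f^*(x))\ne\emptyset$ for $\mathcal{D}_x$-almost all $x$. Moreover, for $\rho>0$ and all $f'\neq f^*_\rho$ in $\mathcal{H}$,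 there exists $\epsilon>0$ with $\mathbb{P}_x(\|w_\rho(f'(x))-w_\rho(f^*_\rho(x))\|\ge\epsilon)>0$. For some $\rho_0>0$ and constants $L_\rho,L_w$: (2A) For all $p\in\Delta_K$ and $\rho_1,\rho_2\in(0,\rho_0]$, $\|w_{\rho_1}(p)-w_{\rho_2}(p)\|\le L_\rho|\rho_1-\rho_2|$. (2B) For all $\rho\in(0,\rho_0]$ and $p_1,p_2\in\Delta_K$, $\|w_\rho(p_1)-w_\rho(p_2)\|\le L_w\|p_1-p_2\|$, the norm on the right being a norm on $\mathbb{R}^K$. (2C) For any $\epsilon>0$ there exists $\delta>0$ such that for all $\rho\in(0,\rho_0]$ and $f\in\mathcal{H}$: if $\mathbb{P}_x(\|w_\rho(f(x))-w_\rho(f^*_\rho(x))\|\ge\epsilon)>0$ then $R(w_\rho\circ f)-R(w_\rho\circ f^*_\rho)\ge\delta$. *)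

theory Defs
  imports "HOL-Probability.Probability"
begin

text \<open>
  The norms on the decision space and on the probability vectors are arbitrary, so they are
  explicit functions rather than the Euclidean \<^const>\<open>norm\<close> of the type class.
\<close>

definition is_norm :: "('a::real_vector \<Rightarrow> real) \<Rightarrow> bool" where
  "is_norm N \<longleftrightarrow>
     (\<forall>v. 0 \<le> N v) \<and>
     (\<forall>v. N v = 0 \<longleftrightarrow> v = 0) \<and>
     (\<forall>a v. N (a *\<^sub>R v) = \<bar>a\<bar> * N v) \<and>
     (\<forall>u v. N (u + v) \<le> N u + N v)"

definition strongly_convex_on :: "('a::real_vector \<Rightarrow> real) \<Rightarrow> 'a set \<Rightarrow> ('a \<Rightarrow> real) \<Rightarrow> bool" where
  "strongly_convex_on N S \<phi> \<longleftrightarrow>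
     (\<exists>\<mu>>0. \<forall>u\<in>S. \<forall>v\<in>S. \<forall>t\<in>{0..1}.
        \<phi> (t *\<^sub>R u + (1 - t) *\<^sub>R v)
          \<le> t * \<phi> u + (1 - t) * \<phi> v - \<mu> / 2 * t * (1 - t) * (N (u - v))\<^sup>2)"

definition dist_to :: "('a::real_vector \<Rightarrow> real) \<Rightarrow> 'a \<Rightarrow> 'a set \<Rightarrow> real" where
  "dist_to N w A = (INF u\<in>A. N (w - u))"

text \<open>The minimum of a real function over a set, to be used where the minimum is attained.\<close>

definition min_over :: "('a \<Rightarrow> real) \<Rightarrow> 'a set \<Rightarrow> real" where
  "min_over g A = (LEAST v. v \<in> g ` A)"

text \<open>
  The scenarios are \<open>z k\<close> for \<open>k\<close> in a finite index type, and a probability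
  vector is an element of \<open>real ^ 'k\<close>.
\<close>

definition prob_simplex :: "(real ^ 'k) set" where
  "prob_simplex = {p. (\<Sum>k\<in>UNIV. p $ k) = 1 \<and> (\<forall>k. 0 \<le> p $ k)}"

definition expected_cost :: "('w \<Rightarrow> 'z \<Rightarrow> real) \<Rightarrow> ('k \<Rightarrow> 'z) \<Rightarrow> real ^ 'k \<Rightarrow> 'w \<Rightarrow> real" where
  "expected_cost c z p w = (\<Sum>k\<in>UNIV. p $ k * c w (z k))"

definition opt_set ::
  "'w set \<Rightarrow> ('w \<Rightarrow> 'z \<Rightarrow> real) \<Rightarrow> ('k \<Rightarrow> 'z) \<Rightarrow> real ^ 'k \<Rightarrow> 'w set" where
  "opt_set S c z p = {w. is_arg_min (expected_cost c z p) (\<lambda>w. w \<in> S) w}"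

definition reg_opt ::
  "'w set \<Rightarrow> ('w \<Rightarrow> 'z \<Rightarrow> real) \<Rightarrow> ('k \<Rightarrow> 'z) \<Rightarrow> ('w \<Rightarrow> real) \<Rightarrow> real \<Rightarrow> real ^ 'k \<Rightarrow> 'w" where
  "reg_opt S c z \<phi> \<rho> p = arg_min_on (\<lambda>w. expected_cost c z p w + \<rho> * \<phi> w) S"

definition risk :: "('x \<times> 'z) measure \<Rightarrow> ('w \<Rightarrow> 'z \<Rightarrow> real) \<Rightarrow> ('x \<Rightarrow> 'w) \<Rightarrow> real" where
  "risk D c \<pi> = (\<integral>y. c (\<pi> (fst y)) (snd y) \<partial>D)"

text \<open>The observations are numbered from 1; the value for \<open>n = 0\<close> is irrelevant.\<close>

definition emp_risk :: "('w \<Rightarrow> 'z \<Rightarrow> real) \<Rightarrow> (nat \<Rightarrow> 'x \<times> 'z) \<Rightarrow> nat \<Rightarrow> ('x \<Rightarrow> 'w) \<Rightarrow> real" where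
  "emp_risk c s n \<pi> = (\<Sum>i=1..n. c (\<pi> (fst (s i))) (snd (s i))) / real n"

definition marginal :: "'x::topological_space set \<Rightarrow> ('x \<times> 'z) measure \<Rightarrow> 'x measure" where
  "marginal X D = distr D (restrict_space borel X) fst"

text \<open>
  \<open>f\<close> is a version, with values in the simplex, of the conditional probabilities of the
  scenarios given the feature vector; the conditioning is on the sigma-algebra generated by
  the first coordinate.
\<close>

definition true_hypothesis ::
  "'x::topological_space set \<Rightarrow> ('x \<times> 'z) measure \<Rightarrow> ('k \<Rightarrow> 'z) \<Rightarrow> ('x \<Rightarrow> real ^ 'k) \<Rightarrow> bool" where
  "true_hypothesis X D z f \<longleftrightarrow>
     f \<in> X \<rightarrow>\<^sub>E prob_simplex \<and>
     f \<in> borel_measurable (restrict_space borel X) \<and>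
     (\<forall>k. AE y in D. f (fst y) $ k =
        real_cond_exp D (vimage_algebra (space D) fst (restrict_space borel X))
          (indicator {y. snd y = z k}) y)"

text \<open>
  The sup-norm is extended-valued because the end points of a bracket may be unbounded.  On
  functions from \<open>X\<close> into the simplex it is finite and \<open>sup_dist\<close> is the sup-norm metric.
\<close>

definition sup_norm :: "('v \<Rightarrow> real) \<Rightarrow> 'x set \<Rightarrow> ('x \<Rightarrow> 'v) \<Rightarrow> ennreal" where
  "sup_norm N X g = (SUP x\<in>X. ennreal (N (g x)))"

definition sup_dist :: "('v::minus \<Rightarrow> real) \<Rightarrow> 'x set \<Rightarrow> ('x \<Rightarrow> 'v) \<Rightarrow> ('x \<Rightarrow> 'v) \<Rightarrow> real" where
  "sup_dist N X f g = enn2real (sup_norm N X (\<lambda>x. f x - g x))"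

definition bracket ::
  "'x set \<Rightarrow> ('x \<Rightarrow> real ^ 'k) set \<Rightarrow> ('x \<Rightarrow> real ^ 'k) \<Rightarrow> ('x \<Rightarrow> real ^ 'k) \<Rightarrow> ('x \<Rightarrow> real ^ 'k) set" where
  "bracket X H l u = {f \<in> H. \<forall>x\<in>X. \<forall>k. l x $ k \<le> f x $ k \<and> f x $ k \<le> u x $ k}"

definition bracketing_number ::
  "(real ^ 'k \<Rightarrow> real) \<Rightarrow> 'x set \<Rightarrow> real \<Rightarrow> ('x \<Rightarrow> real ^ 'k) set \<Rightarrow> enat" where
  "bracketing_number N X \<epsilon> H =
     (INF B \<in> {B. finite B \<and>
                  (\<forall>(l, u)\<in>B. sup_norm N X (\<lambda>x. l x - u x) < ennreal \<epsilon>) \<and>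
                  H \<subseteq> (\<Union>(l, u)\<in>B. bracket X H l u)}.
        enat (card B))"

text \<open>\<open>g r\<close> is the chosen minimizer of the regularized risk with parameter \<open>r\<close>.\<close>

definition identifiable ::
  "'w::real_vector set \<Rightarrow> ('w \<Rightarrow> real) \<Rightarrow> ('w \<Rightarrow> 'z \<Rightarrow> real) \<Rightarrow> ('k \<Rightarrow> 'z) \<Rightarrow> ('w \<Rightarrow> real) \<Rightarrow>
   'x::topological_space set \<Rightarrow> ('x \<times> 'z) measure \<Rightarrow> ('x \<Rightarrow> real ^ 'k) set \<Rightarrow>
   ('x \<Rightarrow> real ^ 'k) \<Rightarrow> (real \<Rightarrow> 'x \<Rightarrow> real ^ 'k) \<Rightarrow> bool" where
  "identifiable S N c z \<phi> X D H fstar g \<longleftrightarrow>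
     \<not> (\<exists>f\<in>H. f \<noteq> fstar \<and>
          (AE x in marginal X D. opt_set S c z (f x) \<inter> opt_set S c z (fstar x) \<noteq> {})) \<and>
     (\<forall>r>0. \<forall>f\<in>H. f \<noteq> g r \<longrightarrow>
        (\<exists>\<epsilon>>0. measure (marginal X D)
          {x \<in> X. N (reg_opt S c z \<phi> r (f x) - reg_opt S c z \<phi> r (g r x)) \<ge> \<epsilon>} > 0))"

definition separated_risk ::
  "'w::real_vector set \<Rightarrow> ('w \<Rightarrow> real) \<Rightarrow> ('w \<Rightarrow> 'z \<Rightarrow> real) \<Rightarrow> ('k \<Rightarrow> 'z) \<Rightarrow> ('w \<Rightarrow> real) \<Rightarrow>
   'x::topological_space set \<Rightarrow> ('x \<times> 'z) measure \<Rightarrow> ('x \<Rightarrow> real ^ 'k) set \<Rightarrow>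
   (real \<Rightarrow> 'x \<Rightarrow> real ^ 'k) \<Rightarrow> real \<Rightarrow> bool" where
  "separated_risk S N c z \<phi> X D H g r0 \<longleftrightarrow>
     (\<forall>\<epsilon>>0. \<exists>\<delta>>0. \<forall>r\<in>{0<..r0}. \<forall>f\<in>H.
        measure (marginal X D)
          {x \<in> X. N (reg_opt S c z \<phi> r (f x) - reg_opt S c z \<phi> r (g r x)) \<ge> \<epsilon>} > 0 \<longrightarrow>
        risk D c (reg_opt S c z \<phi> r \<circ> f) - risk D c (reg_opt S c z \<phi> r \<circ> g r) \<ge> \<delta>)"

end

theory Submission
  imports Defs
begin

text \<open>
  By (2A) the regularized decisions converge, uniformly over the simplex, to a limit \<open>w0 p\<close>,
  which is an optimal decision for \<open>p\<close> and by (2B) Lipschitz in \<open>p\<close>.  Hence the regularized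
  empirical risks differ by a uniformly vanishing amount from those of the fixed policies
  \<open>w0 \<circ> f\<close>.  Since \<open>H\<close> is compact in the sup-norm, finite nets together with Hoeffding's
  inequality and the Borel-Cantelli lemma give a uniform strong law for them.  Conditioning
  on the feature vector shows that the true hypothesis minimizes
  both \<open>f \<mapsto> R (w \<circ> f)\<close> and \<open>f \<mapsto> R (w0 \<circ> f)\<close>, with the same value; this is (i).
  If \<open>R (w0 \<circ> f)\<close> is minimal then \<open>w0 (f x)\<close> lies in both optimal sets for almost every \<open>x\<close>,
  so the minimizer is unique by (1C), and by compactness the empirical minimizers converge
  to it; this is (iii), from which (ii) follows pointwise.
\<close>

section \<open>Equivalence of norms in finite dimension\<close>

text \<open>Expanding a vector in the basis and applying the triangle inequality bounds
  \<open>N\<close> by the coordinates, each of which is at most the Euclidean norm.\<close>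

lemma is_norm_le_norm:
  fixes N :: "'a::euclidean_space \<Rightarrow> real"
  assumes "is_norm N"
  obtains B where "B > 0" "\<And>v. N v \<le> B * norm v"
proof
  have scale: "N (a *\<^sub>R v) = \<bar>a\<bar> * N v" and tri: "N (u + v) \<le> N u + N v"
    and nonneg: "0 \<le> N v" and zero: "N v = 0 \<longleftrightarrow> v = 0" for a u v
    using assms by (auto simp: is_norm_def)
  have sum: "N (sum f A) \<le> (\<Sum>i\<in>A. N (f i))" if "finite A" for f and A :: "'a set"
    using that
  proof (induction A rule: finite_induct)
    case empty
    then show ?case using zero[of 0] by simp
  next
    case (insert a A)
    then show ?case using tri[of "f a" "sum f A"] by simp
  qed
  \<comment> \<open>The summand 1 makes the constant positive at once, from mere nonnegativity of
    \<open>N\<close> on the basis.\<close>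
  let ?B = "1 + (\<Sum>b\<in>Basis. N b)"
  show "?B > 0"
    using nonneg by (simp add: add_pos_nonneg sum_nonneg)
  fix v
  have "N v = N (\<Sum>b\<in>Basis. (v \<bullet> b) *\<^sub>R b)"
    by (simp add: euclidean_representation)
  also have "\<dots> \<le> (\<Sum>b\<in>Basis. \<bar>v \<bullet> b\<bar> * N b)"
    using sum[of Basis "\<lambda>b. (v \<bullet> b) *\<^sub>R b"] by (simp add: scale)
  also have "\<dots> \<le> (\<Sum>b\<in>Basis. norm v * N b)"
    by (intro sum_mono mult_right_mono nonneg Basis_le_norm)
  also have "\<dots> \<le> ?B * norm v"
    by (simp add: sum_distrib_left algebra_simps)
  finally show "N v \<le> ?B * norm v" .
qed

text \<open>The upper bound makes \<open>N\<close> Lipschitz, so it attains a positive minimum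
  \<open>N u\<close> on the compact unit sphere. Homogeneity carries the bound
  \<open>1 / N u\<close> over to all vectors.\<close>

lemma norm_le_is_norm:
  fixes N :: "'a::euclidean_space \<Rightarrow> real"
  assumes "is_norm N"
  obtains B where "B > 0" "\<And>v. norm v \<le> B * N v"
proof -
  have scale: "N (a *\<^sub>R v) = \<bar>a\<bar> * N v" and tri: "N (u + v) \<le> N u + N v"
    and nonneg: "0 \<le> N v" and zero: "N v = 0 \<longleftrightarrow> v = 0" for a u v
    using assms by (auto simp: is_norm_def)
  have sym: "N (u - v) = N (v - u)" for u v
    using scale[of "-1" "u - v"] by simp
  obtain C where C: "C > 0" "\<And>v. N v \<le> C * norm v"
    using is_norm_le_norm[OF assms] by blast
  have lip: "\<bar>N u - N v\<bar> \<le> C * norm (u - v)" for u v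
    using tri[of "u - v" v] tri[of "v - u" u] sym[of u v] C(2)[of "u - v"] by simp
  have "C-lipschitz_on (sphere 0 1) N"
    using lip C by (auto intro!: lipschitz_onI simp: dist_norm)
  then have "continuous_on (sphere 0 1) N"
    by (rule lipschitz_on_continuous_on)
  moreover have ne: "sphere (0::'a) 1 \<noteq> {}"
    by simp
  ultimately obtain u where u: "u \<in> sphere 0 1" "\<And>v. v \<in> sphere 0 1 \<Longrightarrow> N u \<le> N v"
    using continuous_attains_inf[of "sphere (0::'a) 1" N] compact_sphere by blast
  have "N u > 0"
    using u(1) zero[of u] nonneg[of u] by (auto simp: less_le)
  moreover have "norm v \<le> 1 / N u * N v" for v
  proof (cases "v = 0")
    case False
    then have "N u \<le> N ((1 / norm v) *\<^sub>R v)"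
      by (intro u(2)) simp
    then show ?thesis
      using False \<open>N u > 0\<close> by (simp add: scale field_simps)
  qed (use zero[of 0] in simp)
  ultimately show ?thesis
    using that[of "1 / N u"] by simp
qed

section \<open>Strong laws of large numbers, pointwise and uniform\<close>

text \<open>Hoeffding's inequality bounds the probability of a deviation of size \<epsilon> by a
  geometric sequence in \<open>n\<close>. This is summable, so by Borel-Cantelli almost surely only
  finitely many deviations occur.\<close>

lemma (in prob_space) strong_law_bounded:
  fixes h :: "'b \<Rightarrow> real"
  assumes indep: "indep_vars (\<lambda>_. D) Z {1..}"
    and distr: "\<And>i. i \<ge> 1 \<Longrightarrow> distr M D (Z i) = D"
    and h[measurable]: "h \<in> borel_measurable D"
    and bound: "\<And>y. y \<in> space D \<Longrightarrow> \<bar>h y\<bar> \<le> B"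
  shows "AE \<omega> in M. (\<lambda>n::nat. (\<Sum>i=1..n. h (Z i \<omega>)) / real n) \<longlonglongrightarrow> (\<integral>y. h y \<partial>D)"
proof -
  have Z: "Z i \<in> M \<rightarrow>\<^sub>M D" if "i \<ge> 1" for i
    using indep that by (auto simp: indep_vars_def)
  \<comment> \<open>Adding 1 keeps the interval from \<open>-b\<close> to \<open>b\<close>
    nondegenerate; its length is a divisor in Hoeffding's exponent.\<close>
  define b where "b = \<bar>B\<bar> + 1"
  define \<mu> where "\<mu> = (\<integral>y. h y \<partial>D)"
  have b: "b > 0" by (simp add: b_def)
  have hZ[measurable]: "(\<lambda>\<omega>. h (Z i \<omega>)) \<in> borel_measurable M" if "i \<ge> 1" for i
    using measurable_compose[OF Z[OF that] h] .
  have mean: "expectation (\<lambda>\<omega>. h (Z 1 \<omega>)) = \<mu>"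
    unfolding \<mu>_def using integral_distr[OF Z[of 1] h] distr[of 1] by simp
  have ae: "AE \<omega> in M. \<forall>\<^sub>F n in sequentially. \<bar>(\<Sum>i=1..n. h (Z i \<omega>)) / real n - \<mu>\<bar> < \<epsilon>"
    if \<epsilon>: "\<epsilon> > 0" for \<epsilon>
  proof -
    define A where "A n = {\<omega>\<in>space M. \<bar>(\<Sum>i=1..n. h (Z i \<omega>)) / real n - \<mu>\<bar> \<ge> \<epsilon>}" for n :: nat
    \<comment> \<open>The base for which Hoeffding's two-sided bound becomes
      \<open>2 * q ^ n\<close>.\<close>
    define q where "q = exp (- 2 * \<epsilon>\<^sup>2 / (2 * b)\<^sup>2)"
    have meas: "A n \<in> sets M" for n
      unfolding A_def by measurable (auto intro: Z)
    have le: "prob (A n) \<le> 2 * q ^ n" if n: "n \<ge> 1" for n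
    proof -
      interpret Hoeffding_ineq_iid M "{1..n}" "\<lambda>i \<omega>. h (Z i \<omega>)" "\<lambda>\<omega>. h (Z 1 \<omega>)" "-b" b \<mu>
      proof unfold_locales
        show "indep_vars (\<lambda>_. borel) (\<lambda>i \<omega>. h (Z i \<omega>)) {1..n}"
          by (rule indep_vars_compose2[OF indep_vars_subset[OF indep]]) (use n in auto)
        show "distr M borel (\<lambda>\<omega>. h (Z i \<omega>)) = distr M borel (\<lambda>\<omega>. h (Z 1 \<omega>))" if "i \<in> {1..n}" for i
          using distr_distr[OF h Z[of i]] distr_distr[OF h Z[of 1]] that distr[of i] distr[of 1]
          by (simp add: o_def Z)
        show "AE \<omega> in M. h (Z 1 \<omega>) \<in> {- b..b}"
        proof (rule AE_I2)
          fix \<omega> assume "\<omega> \<in> space M"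
          then have "\<bar>h (Z 1 \<omega>)\<bar> \<le> B"
            using Z[of 1] by (intro bound) (auto dest: measurable_space)
          then show "h (Z 1 \<omega>) \<in> {- b..b}"
            unfolding b_def by auto
        qed
      qed (use mean hZ in auto)
      have "prob (A n) \<le> 2 * exp (- 2 * real n * \<epsilon>\<^sup>2 / (b - - b)\<^sup>2)"
        using Hoeffding_ineq_abs_ge'[of \<epsilon>] \<epsilon> b n unfolding A_def by simp
      also have "exp (- 2 * real n * \<epsilon>\<^sup>2 / (b - - b)\<^sup>2) = q ^ n"
        unfolding q_def by (simp flip: exp_of_nat_mult)
      finally show ?thesis .
    qed
    have q: "0 < q" "q < 1"
      using \<epsilon> b by (auto simp: q_def)
    have "summable (\<lambda>n. prob (A n))"
    proof (rule summable_comparison_test')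
      show "summable (\<lambda>n. 2 * q ^ n)"
        using q by (intro summable_mult summable_geometric) auto
      show "norm (prob (A n)) \<le> 2 * q ^ n" if "n \<ge> 1" for n
        using le[OF that] by simp
    qed
    then have "AE \<omega> in M. \<forall>\<^sub>F n in sequentially. \<omega> \<in> space M - A n"
      using meas by (intro borel_cantelli_AE1) (auto simp: emeasure_eq_measure)
    then show ?thesis
      by eventually_elim (auto simp: A_def elim!: eventually_mono)
  qed
  \<comment> \<open>Countably many tolerances suffice for the limit and leave a single null
    set.\<close>
  have "AE \<omega> in M. \<forall>m. \<forall>\<^sub>F n in sequentially.
      \<bar>(\<Sum>i=1..n. h (Z i \<omega>)) / real n - \<mu>\<bar> < inverse (real (Suc m))"
    unfolding AE_all_countable by (intro allI ae) simp
  then show ?thesis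
    unfolding \<mu>_def[symmetric]
  proof eventually_elim
    case (elim \<omega>)
    show ?case
    proof (rule tendstoI)
      fix e :: real assume "e > 0"
      then obtain m where m: "inverse (real (Suc m)) < e"
        using reals_Archimedean by blast
      show "\<forall>\<^sub>F n in sequentially. dist ((\<Sum>i=1..n. h (Z i \<omega>)) / real n) \<mu> < e"
        using elim[rule_format, of m] by eventually_elim (use m in \<open>simp add: dist_real_def\<close>)
    qed
  qed
qed

text \<open>Although \<open>H\<close> may be uncountable, the exceptional event is a countable union
  of null sets: one for each element of the finite nets with mesh \<open>1 / (m + 1)\<close>. Off
  this event every \<open>f\<close> is compared with a nearby net element \<open>g\<close>, which
  needs no measurability of a supremum over \<open>H\<close>.\<close>

lemma (in prob_space) uniform_strong_law:
  fixes h :: "'f \<Rightarrow> 'b \<Rightarrow> real"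
  assumes indep: "indep_vars (\<lambda>_. D) Z {1..}"
    and distr: "\<And>i. i \<ge> 1 \<Longrightarrow> distr M D (Z i) = D"
    and meas: "\<And>f. f \<in> H \<Longrightarrow> h f \<in> borel_measurable D"
    and bound: "\<And>f y. f \<in> H \<Longrightarrow> y \<in> space D \<Longrightarrow> \<bar>h f y\<bar> \<le> B"
    and net: "\<And>\<epsilon>. \<epsilon> > 0 \<Longrightarrow>
      \<exists>F. finite F \<and> F \<subseteq> H \<and> (\<forall>f\<in>H. \<exists>g\<in>F. \<forall>y\<in>space D. \<bar>h f y - h g y\<bar> \<le> \<epsilon>)"
  shows "AE \<omega> in M. \<forall>\<epsilon>>0. \<forall>\<^sub>F n :: nat in sequentially. \<forall>f\<in>H.
    \<bar>(\<Sum>i=1..n. h f (Z i \<omega>)) / real n - (\<integral>y. h f y \<partial>D)\<bar> \<le> \<epsilon>"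
proof -
  have Z: "Z i \<in> M \<rightarrow>\<^sub>M D" if "i \<ge> 1" for i
    using indep that by (auto simp: indep_vars_def)
  interpret D: prob_space D
    using prob_space_distr[OF Z[of 1]] distr[of 1] by simp
  have int: "integrable D (h f)" if "f \<in> H" for f
    by (rule D.integrable_const_bound[where B = B]) (use that meas bound in auto)
  have "\<exists>F. \<forall>m. finite (F m) \<and> F m \<subseteq> H \<and>
      (\<forall>f\<in>H. \<exists>g\<in>F m. \<forall>y\<in>space D. \<bar>h f y - h g y\<bar> \<le> inverse (real (Suc m)))"
    by (intro choice allI net) simp
  then obtain F where F: "\<And>m. finite (F m)" "\<And>m. F m \<subseteq> H"
    "\<And>m f. f \<in> H \<Longrightarrow> \<exists>g\<in>F m. \<forall>y\<in>space D. \<bar>h f y - h g y\<bar> \<le> inverse (real (Suc m))"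
    by metis
  have "AE \<omega> in M. \<forall>m. \<forall>g\<in>F m.
      (\<lambda>n::nat. (\<Sum>i=1..n. h g (Z i \<omega>)) / real n) \<longlonglongrightarrow> (\<integral>y. h g y \<partial>D)"
    unfolding AE_all_countable
  proof (intro allI AE_finite_allI F)
    fix m g assume "g \<in> F m"
    then have "g \<in> H" using F by blast
    then show "AE \<omega> in M. (\<lambda>n::nat. (\<Sum>i=1..n. h g (Z i \<omega>)) / real n) \<longlonglongrightarrow> (\<integral>y. h g y \<partial>D)"
      by (intro strong_law_bounded[OF indep distr meas bound]) auto
  qed
  then show ?thesis
  proof (rule AE_mp, intro AE_I2 impI allI)
    fix \<omega> :: 'a and \<epsilon> :: real
    assume \<omega>: "\<omega> \<in> space M" and lim: "\<forall>m. \<forall>g\<in>F m.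
      (\<lambda>n::nat. (\<Sum>i=1..n. h g (Z i \<omega>)) / real n) \<longlonglongrightarrow> (\<integral>y. h g y \<partial>D)" and "\<epsilon> > 0"
    \<comment> \<open>The thirds pay for the gap between the sample means of \<open>f\<close> and
      \<open>g\<close>, the law for \<open>g\<close>, and the gap between the two integrals.\<close>
    then obtain m where m: "inverse (real (Suc m)) < \<epsilon> / 3"
      using reals_Archimedean[of "\<epsilon> / 3"] by auto
    have "\<forall>\<^sub>F n in sequentially. \<bar>(\<Sum>i=1..n. h g (Z i \<omega>)) / real n - (\<integral>y. h g y \<partial>D)\<bar> < \<epsilon> / 3"
      if "g \<in> F m" for g
      using tendstoD[OF lim[rule_format, OF that], of "\<epsilon> / 3"] \<open>\<epsilon> > 0\<close>
      by (simp add: dist_real_def)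
    then have "\<forall>\<^sub>F n in sequentially. \<forall>g\<in>F m.
        \<bar>(\<Sum>i=1..n. h g (Z i \<omega>)) / real n - (\<integral>y. h g y \<partial>D)\<bar> < \<epsilon> / 3"
      using F(1) by (simp add: eventually_ball_finite)
    then show "\<forall>\<^sub>F n in sequentially. \<forall>f\<in>H.
        \<bar>(\<Sum>i=1..n. h f (Z i \<omega>)) / real n - (\<integral>y. h f y \<partial>D)\<bar> \<le> \<epsilon>"
    proof eventually_elim
      case (elim n)
      show ?case
      proof
        fix f assume f: "f \<in> H"
        then obtain g where g: "g \<in> F m" "\<And>y. y \<in> space D \<Longrightarrow> \<bar>h f y - h g y\<bar> \<le> inverse (real (Suc m))"
          using F(3) by blast
        then have gH: "g \<in> H" using F by blast
        have close: "\<bar>h f y - h g y\<bar> \<le> \<epsilon> / 3" if "y \<in> space D" for y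
          using g(2)[OF that] m by linarith
        have "\<bar>(\<Sum>i=1..n. h f (Z i \<omega>)) - (\<Sum>i=1..n. h g (Z i \<omega>))\<bar> \<le> (\<Sum>i=1..n. \<epsilon> / 3)"
          unfolding sum_subtractf[symmetric]
          by (rule order_trans[OF sum_abs], intro sum_mono close)
             (use \<omega> Z in \<open>auto dest!: measurable_space\<close>)
        \<comment> \<open>For \<open>n = 0\<close> both quotients are 0, since division by zero
          yields 0.\<close>
        then have "\<bar>(\<Sum>i=1..n. h f (Z i \<omega>)) / real n - (\<Sum>i=1..n. h g (Z i \<omega>)) / real n\<bar> \<le> \<epsilon> / 3"
          using \<open>\<epsilon> > 0\<close> by (cases "n = 0") (simp_all flip: diff_divide_distrib add: field_simps)
        moreover have "\<bar>(\<integral>y. h f y \<partial>D) - (\<integral>y. h g y \<partial>D)\<bar> \<le> \<epsilon> / 3"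
        proof -
          have "\<bar>(\<integral>y. h f y \<partial>D) - (\<integral>y. h g y \<partial>D)\<bar> = \<bar>\<integral>y. h f y - h g y \<partial>D\<bar>"
            using f gH by (simp add: int)
          also have "\<dots> \<le> (\<integral>y. \<bar>h f y - h g y\<bar> \<partial>D)"
            by (rule integral_abs_bound)
          also have "\<dots> \<le> \<epsilon> / 3"
            using f gH close by (intro D.integral_le_const) (auto intro!: integrable_abs Bochner_Integration.integrable_diff int)
          finally show ?thesis .
        qed
        ultimately show "\<bar>(\<Sum>i=1..n. h f (Z i \<omega>)) / real n - (\<integral>y. h f y \<partial>D)\<bar> \<le> \<epsilon>"
          using elim[rule_format, OF g(1)] by linarith
      qed
    qed
  qed
qed

section \<open>Strict minimizers on compact metric spaces\<close>

text \<open>Otherwise there are points at distance at least \<epsilon> from \<open>a\<close> whose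
  values exceed \<open>F a\<close> by less than \<open>1 / (n + 1)\<close>. A subsequence converges,
  by continuity its limit is a minimizer and so equals \<open>a\<close>, and this contradicts the
  distance.\<close>

lemma (in Metric_space) unique_minimizer_well_separated:
  fixes F :: "'a \<Rightarrow> real"
  assumes compact: "compact_space mtopology" and a: "a \<in> M"
    and cont: "\<And>\<epsilon>. \<epsilon> > 0 \<Longrightarrow> \<exists>\<delta>>0. \<forall>x\<in>M. \<forall>y\<in>M. d x y < \<delta> \<longrightarrow> \<bar>F x - F y\<bar> \<le> \<epsilon>"
    and min: "\<And>x. x \<in> M \<Longrightarrow> x \<noteq> a \<Longrightarrow> F a < F x"
    and \<epsilon>: "\<epsilon> > 0"
  obtains \<eta> where "\<eta> > 0" "\<And>x. x \<in> M \<Longrightarrow> d x a \<ge> \<epsilon> \<Longrightarrow> F a + \<eta> \<le> F x"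
proof (rule ccontr)
  assume "\<not> thesis"
  then have "\<exists>x\<in>M. d x a \<ge> \<epsilon> \<and> F x < F a + inverse (real (Suc n))" for n
    using that[of "inverse (real (Suc n))"] by (force simp: not_le)
  then obtain \<sigma> where \<sigma>: "\<And>n. \<sigma> n \<in> M" "\<And>n. d (\<sigma> n) a \<ge> \<epsilon>"
    "\<And>n. F (\<sigma> n) < F a + inverse (real (Suc n))"
    by metis
  then obtain l r where l: "l \<in> M" "strict_mono r" "limitin mtopology (\<sigma> \<circ> r) l sequentially"
    using compact unfolding compact_space_sequentially by blast
  have near: "\<exists>K. \<forall>n\<ge>K. d (\<sigma> (r n)) l < e" if "e > 0" for e
    using l(3) that unfolding limit_metric_sequentially by (metis comp_apply)
  have "F l \<le> F a + e" if e: "e > 0" for e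
  proof -
    obtain \<delta> where \<delta>: "\<delta> > 0" "\<And>x y. x \<in> M \<Longrightarrow> y \<in> M \<Longrightarrow> d x y < \<delta> \<Longrightarrow> \<bar>F x - F y\<bar> \<le> e / 2"
      using cont[of "e / 2"] e by auto
    obtain K where K: "\<And>n. n \<ge> K \<Longrightarrow> d (\<sigma> (r n)) l < \<delta>"
      using near[OF \<delta>(1)] by blast
    obtain m where m: "inverse (real (Suc m)) < e / 2"
      using reals_Archimedean[of "e / 2"] e by auto
    \<comment> \<open>Being past \<open>K\<close> brings \<open>F (\<sigma> (r n))\<close> within
      \<open>e / 2\<close> of \<open>F l\<close>; being past \<open>m\<close>, together with
      \<open>n \<le> r n\<close>, makes the excess over \<open>F a\<close> smaller than
      \<open>e / 2\<close>.\<close>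
    define n where "n = max K m"
    have "m \<le> r n"
      using seq_suble[OF l(2), of n] by (simp add: n_def)
    then have "inverse (real (Suc (r n))) \<le> inverse (real (Suc m))"
      by (intro le_imp_inverse_le) auto
    moreover have "\<bar>F (\<sigma> (r n)) - F l\<bar> \<le> e / 2"
      using K[of n] by (intro \<delta>(2) \<sigma> l) (simp add: n_def)
    ultimately show ?thesis
      using \<sigma>(3)[of "r n"] m by linarith
  qed
  then have "F l \<le> F a"
    by (rule field_le_epsilon)
  then have "l = a"
    using min[OF l(1)] by force
  moreover obtain K where "d (\<sigma> (r K)) l < \<epsilon>"
    using near[OF \<epsilon>] by blast
  ultimately show False
    using \<sigma>(2)[of "r K"] by simp
qed

section \<open>Attained minima and the sup-norm metric\<close>

lemma min_over_arg_min:
  fixes g :: "'a \<Rightarrow> real"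
  assumes "is_arg_min g (\<lambda>x. x \<in> A) a"
  shows "min_over g A = g a"
  unfolding min_over_def
  by (rule Least_equality) (use assms in \<open>auto simp: is_arg_min_linorder\<close>)

lemma norm_prob_simplex_le:
  assumes "p \<in> prob_simplex"
  shows "norm p \<le> 1"
  using norm_le_l1_cart[of p] assms by (simp add: prob_simplex_def)

text \<open>\<open>enn2real\<close> sends an infinite supremum to 0, so the estimate relies on a
  uniform bound \<open>B\<close>, whose value is irrelevant.\<close>

lemma sup_dist_upper:
  assumes "\<And>x. x \<in> X \<Longrightarrow> N (f x - g x) \<le> B" "x \<in> X" and nonneg: "\<And>v. 0 \<le> N v"
  shows "N (f x - g x) \<le> sup_dist N X f g"
proof -
  have "sup_norm N X (\<lambda>x. f x - g x) \<le> ennreal B"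
    unfolding sup_norm_def using assms by (intro SUP_least ennreal_leI) auto
  then have "sup_norm N X (\<lambda>x. f x - g x) < top"
    by (rule order.strict_trans1) simp
  moreover have "ennreal (N (f x - g x)) \<le> sup_norm N X (\<lambda>x. f x - g x)"
    unfolding sup_norm_def by (rule SUP_upper[OF assms(2)])
  ultimately have "enn2real (ennreal (N (f x - g x))) \<le> sup_dist N X f g"
    unfolding sup_dist_def by (intro enn2real_mono)
  then show ?thesis
    using nonneg by simp
qed

lemma sup_dist_least:
  assumes "\<And>x. x \<in> X \<Longrightarrow> N (f x - g x) \<le> B" "0 \<le> B"
  shows "sup_dist N X f g \<le> B"
  unfolding sup_dist_def sup_norm_def
  by (intro enn2real_leI SUP_least ennreal_leI assms)

text \<open>Boundedness keeps all suprema finite. Extensionality makes functions that agree on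
  \<open>X\<close> equal, so that distance 0 implies equality.\<close>

lemma Metric_space_sup_dist:
  fixes N :: "'v::real_vector \<Rightarrow> real"
  assumes N: "is_norm N" and ext: "H \<subseteq> extensional X"
    and bound: "\<And>f x. f \<in> H \<Longrightarrow> x \<in> X \<Longrightarrow> N (f x) \<le> B"
  shows "Metric_space H (sup_dist N X)"
proof
  have scale: "N (a *\<^sub>R v) = \<bar>a\<bar> * N v" and tri: "N (u + v) \<le> N u + N v"
    and nonneg: "0 \<le> N v" and zero: "N v = 0 \<longleftrightarrow> v = 0" for a u v
    using N by (auto simp: is_norm_def)
  have sym: "N (u - v) = N (v - u)" for u v
    using scale[of "-1" "u - v"] by simp
  have diff: "N (u - v) \<le> N u + N v" for u v
    using tri[of u "- v"] scale[of "-1" v] by simp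
  have upper: "N (f x - g x) \<le> sup_dist N X f g" if "f \<in> H" "g \<in> H" "x \<in> X" for f g x
  proof (rule sup_dist_upper)
    show "N (f y - g y) \<le> B + B" if "y \<in> X" for y
      using diff[of "f y" "g y"] bound[of f y] bound[of g y] \<open>f \<in> H\<close> \<open>g \<in> H\<close> that by linarith
  qed (use that nonneg in auto)
  show dist_nonneg: "0 \<le> sup_dist N X f g" for f g
    by (simp add: sup_dist_def)
  show "sup_dist N X f g = sup_dist N X g f" for f g
    by (simp add: sup_dist_def sup_norm_def sym)
  show "sup_dist N X f g = 0 \<longleftrightarrow> f = g" if fg: "f \<in> H" "g \<in> H" for f g
  proof
    assume eq: "sup_dist N X f g = 0"
    show "f = g"
    proof (rule extensionalityI)
      show "f x = g x" if "x \<in> X" for x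
        using upper[OF fg that] nonneg[of "f x - g x"] zero[of "f x - g x"] eq by simp
    qed (use fg ext in auto)
  next
    assume "f = g"
    then have "sup_dist N X f g \<le> 0"
      using zero[of 0] by (intro sup_dist_least) auto
    then show "sup_dist N X f g = 0"
      using dist_nonneg[of f g] by simp
  qed
  show "sup_dist N X f h \<le> sup_dist N X f g + sup_dist N X g h"
    if "f \<in> H" "g \<in> H" "h \<in> H" for f g h
  proof (rule sup_dist_least)
    show "N (f x - h x) \<le> sup_dist N X f g + sup_dist N X g h" if "x \<in> X" for x
      using tri[of "f x - g x" "g x - h x"] upper[of f g x] upper[of g h x] that
        \<open>f \<in> H\<close> \<open>g \<in> H\<close> \<open>h \<in> H\<close> by simp
  qed (simp add: dist_nonneg)
qed

section \<open>Regularized decisions and their limit for vanishing regularization\<close>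

lemma continuous_on_expected_cost:
  fixes c :: "'w::topological_space \<Rightarrow> 'z \<Rightarrow> real"
  assumes "\<And>k. continuous_on S (\<lambda>v. c v (z k))"
  shows "continuous_on S (expected_cost c z p)"
  unfolding expected_cost_def[abs_def] by (intro continuous_intros assms)

text \<open>\<open>reg_opt\<close> is a Hilbert choice, which has the chosen property once some
  minimizer exists; compactness and continuity provide one.\<close>

lemma reg_opt_is_arg_min:
  fixes c :: "'w::topological_space \<Rightarrow> 'z \<Rightarrow> real"
  assumes S: "S \<noteq> {}" "compact S"
    and c: "\<And>k. continuous_on S (\<lambda>v. c v (z k))" and \<phi>: "continuous_on S \<phi>"
  shows "is_arg_min (\<lambda>v. expected_cost c z p v + r * \<phi> v) (\<lambda>v. v \<in> S) (reg_opt S c z \<phi> r p)"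
proof -
  have "continuous_on S (\<lambda>v. expected_cost c z p v + r * \<phi> v)"
    by (intro continuous_intros continuous_on_expected_cost c \<phi>)
  then obtain v where "is_arg_min (\<lambda>v. expected_cost c z p v + r * \<phi> v) (\<lambda>v. v \<in> S) v"
    using continuous_attains_inf[OF S(2,1)] by (metis is_arg_min_linorder)
  then show ?thesis
    unfolding reg_opt_def arg_min_on_def arg_min_def by (rule someI)
qed

text \<open>For fixed \<open>p\<close> the decision is Lipschitz in the regularization parameter,
  hence has a limit at 0 with an error linear in that parameter. The Lipschitz estimate in
  \<open>p\<close> and optimality are non-strict inequalities and survive the passage to the
  limit.\<close>

lemma vanishing_regularization:
  fixes S :: "'w::euclidean_space set" and c :: "'w \<Rightarrow> 'z \<Rightarrow> real"
    and z :: "'k::finite \<Rightarrow> 'z" and \<phi> :: "'w \<Rightarrow> real"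
  defines "u \<equiv> reg_opt S c z \<phi>"
  assumes S: "S \<noteq> {}" "compact S"
    and c: "\<And>k. continuous_on S (\<lambda>v. c v (z k))"
    and \<phi>: "continuous_on S \<phi>" "\<And>v. v \<in> S \<Longrightarrow> 0 \<le> \<phi> v"
    and r0: "r0 > 0" and A: "A \<ge> 0"
    and lip_r: "\<And>p r s. p \<in> prob_simplex \<Longrightarrow> r \<in> {0<..r0} \<Longrightarrow> s \<in> {0<..r0} \<Longrightarrow>
      norm (u r p - u s p) \<le> A * \<bar>r - s\<bar>"
    and lip_p: "\<And>p q r. p \<in> prob_simplex \<Longrightarrow> q \<in> prob_simplex \<Longrightarrow> r \<in> {0<..r0} \<Longrightarrow>
      norm (u r p - u r q) \<le> L * norm (p - q)"
  obtains u0 where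
    "\<And>p r. p \<in> prob_simplex \<Longrightarrow> r \<in> {0<..r0} \<Longrightarrow> norm (u r p - u0 p) \<le> A * r"
    "\<And>p q. p \<in> prob_simplex \<Longrightarrow> q \<in> prob_simplex \<Longrightarrow> norm (u0 p - u0 q) \<le> L * norm (p - q)"
    "\<And>p. p \<in> prob_simplex \<Longrightarrow> u0 p \<in> opt_set S c z p"
proof -
  have "\<exists>v. \<forall>r\<in>{0<..r0}. norm (u r p - v) \<le> A * r" if p: "p \<in> prob_simplex" for p
  proof -
    have "A-lipschitz_on {0<..r0} (\<lambda>r. u r p)"
      using lip_r[OF p] A by (auto intro!: lipschitz_onI simp: dist_norm)
    \<comment> \<open>The closure of the parameter interval contains 0, and the value of the
      extension there is the limit decision.\<close>
    then obtain g where g: "A-lipschitz_on (closure {0<..r0}) g" "\<forall>r\<in>{0<..r0}. g r = u r p"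
      using lipschitz_extend_closure by blast
    have "norm (u r p - g 0) \<le> A * r" if "r \<in> {0<..r0}" for r
      using lipschitz_onD[OF g(1), of r 0] g(2) that r0 by (simp add: dist_norm)
    then show ?thesis by blast
  qed
  then obtain u0 where u0: "\<And>p r. p \<in> prob_simplex \<Longrightarrow> r \<in> {0<..r0} \<Longrightarrow> norm (u r p - u0 p) \<le> A * r"
    by metis
  have ev: "\<forall>\<^sub>F r in at_right 0. r \<in> {0<..r0}"
    unfolding eventually_at_right_field using r0 by (intro exI[of _ r0]) auto
  have lim: "((\<lambda>r. u r p) \<longlongrightarrow> u0 p) (at_right 0)" if p: "p \<in> prob_simplex" for p
  proof (rule Lim_null_comparison[THEN Lim_null[THEN iffD2]])
    show "\<forall>\<^sub>F r in at_right 0. norm (u r p - u0 p) \<le> A * r"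
      using ev by eventually_elim (rule u0[OF p])
    show "((\<lambda>r. A * r) \<longlongrightarrow> 0) (at_right 0)"
      by (auto intro!: tendsto_eq_intros)
  qed
  have nontriv: "at_right (0::real) \<noteq> bot"
    by (rule trivial_limit_at_right_real)
  have opt: "is_arg_min (\<lambda>v. expected_cost c z p v + r * \<phi> v) (\<lambda>v. v \<in> S) (u r p)" for r p
    unfolding u_def by (rule reg_opt_is_arg_min) (fact S c \<phi>(1))+
  then have uS: "u r p \<in> S" for r p
    by (auto simp: is_arg_min_def)
  show ?thesis
  proof
    show "norm (u0 p - u0 q) \<le> L * norm (p - q)" if "p \<in> prob_simplex" "q \<in> prob_simplex" for p q
    proof (rule tendsto_upperbound[OF _ _ nontriv])
      show "((\<lambda>r. norm (u r p - u r q)) \<longlongrightarrow> norm (u0 p - u0 q)) (at_right 0)"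
        using that by (intro tendsto_intros lim)
      show "\<forall>\<^sub>F r in at_right 0. norm (u r p - u r q) \<le> L * norm (p - q)"
        using ev by eventually_elim (rule lip_p[OF that])
    qed
    show "u0 p \<in> opt_set S c z p" if p: "p \<in> prob_simplex" for p
    proof -
      have S0: "u0 p \<in> S"
        by (rule Lim_in_closed_set[OF compact_imp_closed[OF S(2)] _ nontriv lim[OF p]]) (intro always_eventually allI uS)
      \<comment> \<open>In the inequality expressing regularized minimality, the nonnegative penalty
        on the left is dropped, and the penalty on the right vanishes as \<open>r\<close> tends to
        0.\<close>
      have "expected_cost c z p (u0 p) \<le> expected_cost c z p v" if v: "v \<in> S" for v
      proof (rule tendsto_le[OF nontriv])
        show "((\<lambda>r. expected_cost c z p (u r p)) \<longlongrightarrow> expected_cost c z p (u0 p)) (at_right 0)"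
          by (rule continuous_on_tendsto_compose[OF continuous_on_expected_cost lim[OF p] S0])
             (intro c always_eventually allI uS)+
        show "((\<lambda>r. expected_cost c z p v + r * \<phi> v) \<longlongrightarrow> expected_cost c z p v) (at_right 0)"
          by (auto intro!: tendsto_eq_intros)
        show "\<forall>\<^sub>F r in at_right 0. expected_cost c z p (u r p) \<le> expected_cost c z p v + r * \<phi> v"
          using ev
        proof eventually_elim
          case (elim r)
          then have "0 \<le> r * \<phi> (u r p)"
            using \<phi>(2)[OF uS] by simp
          moreover have "expected_cost c z p (u r p) + r * \<phi> (u r p) \<le> expected_cost c z p v + r * \<phi> v"
            using opt v by (auto simp: is_arg_min_linorder)
          ultimately show ?case by linarith
        qed
      qed
      then show ?thesis
        using S0 by (auto simp: opt_set_def is_arg_min_linorder)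
    qed
  qed (rule u0)
qed

section \<open>Uniform convergence of objectives and uniform bounds for the costs\<close>

text \<open>If \<open>E n\<close> and \<open>G\<close> differ by at most \<epsilon>, then
  \<open>G (s n)\<close> is at most \<open>E n (s n) + \<epsilon>\<close>, hence at most
  \<open>E n a + \<epsilon>\<close>, hence at most \<open>G a + 2 * \<epsilon>\<close>; the lower
  bounds come from minimality of \<open>a\<close>. Both limits follow from this chain.\<close>

lemma uniform_convergence_arg_min:
  fixes E :: "nat \<Rightarrow> 'f \<Rightarrow> real"
  assumes unif: "\<And>\<epsilon>. \<epsilon> > 0 \<Longrightarrow> \<forall>\<^sub>F n in sequentially. \<forall>f\<in>H. \<bar>E n f - G f\<bar> \<le> \<epsilon>"
    and arg_min: "\<forall>\<^sub>F n in sequentially. is_arg_min (E n) (\<lambda>f. f \<in> H) (s n)"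
    and a: "is_arg_min G (\<lambda>f. f \<in> H) a"
  shows "(\<lambda>n. min_over (E n) H) \<longlonglongrightarrow> G a" "(\<lambda>n. G (s n)) \<longlonglongrightarrow> G a"
proof -
  have ev: "\<forall>\<^sub>F n in sequentially. dist (min_over (E n) H) (G a) < \<epsilon> \<and> dist (G (s n)) (G a) < \<epsilon>"
    if \<epsilon>: "\<epsilon> > 0" for \<epsilon>
  proof -
    have "\<epsilon> / 3 > 0" using \<epsilon> by simp
    from unif[OF this] arg_min show ?thesis
    proof eventually_elim
      case (elim n)
      have H: "a \<in> H" "s n \<in> H"
        using a elim(2) by (auto simp: is_arg_min_def)
      have "E n (s n) \<le> E n a" "G a \<le> G (s n)"
        using a elim(2) H by (auto simp: is_arg_min_linorder)
      then show ?case
        using elim(1)[rule_format, OF H(1)] elim(1)[rule_format, OF H(2)] \<epsilon>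
        unfolding min_over_arg_min[OF elim(2)] dist_real_def by linarith
    qed
  qed
  show "(\<lambda>n. min_over (E n) H) \<longlonglongrightarrow> G a"
    by (rule tendstoI, drule ev, erule eventually_mono) simp
  show "(\<lambda>n. G (s n)) \<longlonglongrightarrow> G a"
    by (rule tendstoI, drule ev, erule eventually_mono) simp
qed

lemma compact_uniformly_bounded_equicontinuous:
  fixes c :: "'w::metric_space \<Rightarrow> 'z \<Rightarrow> real" and z :: "'k::finite \<Rightarrow> 'z"
  assumes S: "compact S" and c: "\<And>k. continuous_on S (\<lambda>v. c v (z k))"
  obtains B where "\<And>v k. v \<in> S \<Longrightarrow> \<bar>c v (z k)\<bar> \<le> B"
    and "\<And>\<epsilon>. \<epsilon> > 0 \<Longrightarrow> \<exists>\<delta>>0. \<forall>u\<in>S. \<forall>v\<in>S. \<forall>k. dist u v < \<delta> \<longrightarrow> \<bar>c u (z k) - c v (z k)\<bar> \<le> \<epsilon>"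
proof -
  \<comment> \<open>Collecting the scenario costs in one vector-valued map yields a single bound and
    a single modulus of continuity for all \<open>k\<close>.\<close>
  define C where "C v = (\<chi> k. c v (z k))" for v
  have cont: "continuous_on S C"
    unfolding C_def by (intro continuous_on_vec_lambda c)
  then obtain B where B: "\<And>v. v \<in> S \<Longrightarrow> norm (C v) \<le> B"
    using compact_imp_bounded[OF compact_continuous_image[OF cont S]] unfolding bounded_iff by blast
  have unif: "uniformly_continuous_on S C"
    by (rule compact_uniformly_continuous[OF cont S])
  show ?thesis
  proof
    show "\<bar>c v (z k)\<bar> \<le> B" if "v \<in> S" for v k
      using component_le_norm_cart[of "C v" k] B[OF that] by (simp add: C_def)
    show "\<exists>\<delta>>0. \<forall>u\<in>S. \<forall>v\<in>S. \<forall>k. dist u v < \<delta> \<longrightarrow> \<bar>c u (z k) - c v (z k)\<bar> \<le> \<epsilon>"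
      if "\<epsilon> > 0" for \<epsilon>
    proof -
      obtain \<delta> where \<delta>: "\<delta> > 0" "\<And>u v. u \<in> S \<Longrightarrow> v \<in> S \<Longrightarrow> dist u v < \<delta> \<Longrightarrow> dist (C u) (C v) < \<epsilon>"
        using unif \<open>\<epsilon> > 0\<close> unfolding uniformly_continuous_on_def by (metis dist_commute)
      have "\<bar>c u (z k) - c v (z k)\<bar> \<le> \<epsilon>" if "u \<in> S" "v \<in> S" "dist u v < \<delta>" for u v k
        using component_le_norm_cart[of "C u - C v" k] \<delta>(2)[OF that] by (simp add: C_def dist_norm)
      then show ?thesis
        using \<delta>(1) by blast
    qed
  qed
qed

section \<open>Conditioning on the feature vector\<close>

locale finite_scenarios = prob_space D
  for X :: "'x::topological_space set" and D :: "('x \<times> 'z) measure" and z :: "'k::finite \<Rightarrow> 'z" +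
  assumes inj_z: "inj z"
    and sets_D: "sets D = sets (restrict_space borel X \<Otimes>\<^sub>M count_space (range z))"
begin

abbreviation "feature_space \<equiv> restrict_space borel X"

lemma space_D: "space D = X \<times> range z"
  using sets_eq_imp_space_eq[OF sets_D] by (simp add: space_pair_measure space_restrict_space)

lemma fst_measurable [measurable]: "fst \<in> D \<rightarrow>\<^sub>M feature_space"
  by (simp add: measurable_cong_sets[OF sets_D refl])

lemma snd_measurable [measurable]: "snd \<in> D \<rightarrow>\<^sub>M count_space (range z)"
  by (simp add: measurable_cong_sets[OF sets_D refl])

lemma scenario_measurable [measurable]: "(\<lambda>y. indicator {y. snd y = z k} y :: real) \<in> borel_measurable D"
proof -
  have "(\<lambda>s. indicator {z k} s :: real) \<in> borel_measurable (count_space (range z))"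
    by simp
  from measurable_compose[OF snd_measurable this] show ?thesis
    by (rule measurable_cong[THEN iffD1, rotated]) (auto simp: indicator_def)
qed

text \<open>Every observation carries some scenario, and injectivity of \<open>z\<close> makes
  exactly one indicator nonzero.\<close>

lemma cost_decomposition:
  fixes c :: "'w \<Rightarrow> 'z \<Rightarrow> real"
  assumes "y \<in> space D"
  shows "c (\<pi> (fst y)) (snd y) =
    (\<Sum>k\<in>UNIV. c (\<pi> (fst y)) (z k) * indicator {y. snd y = z k} y)"
proof -
  obtain j where j: "snd y = z j"
    using assms space_D by auto
  have "(\<Sum>k\<in>UNIV. c (\<pi> (fst y)) (z k) * indicator {y. snd y = z k} y) =
      (\<Sum>k\<in>UNIV. if k = j then c (\<pi> (fst y)) (z k) else 0)"
    by (intro sum.cong refl) (auto simp: indicator_def j inj_eq[OF inj_z])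
  then show ?thesis
    by (simp add: j)
qed

text \<open>The finite decomposition reduces measurability in the pair to measurability in the
  feature for each fixed scenario.\<close>

lemma cost_measurable:
  fixes c :: "'w \<Rightarrow> 'z \<Rightarrow> real"
  assumes "\<And>k. (\<lambda>x. c (\<pi> x) (z k)) \<in> borel_measurable feature_space"
  shows "(\<lambda>y. c (\<pi> (fst y)) (snd y)) \<in> borel_measurable D"
proof (subst measurable_cong[OF cost_decomposition[of _ c \<pi>]])
  have [measurable]: "(\<lambda>y. c (\<pi> (fst y)) (z k)) \<in> borel_measurable D" for k
    using measurable_compose[OF fst_measurable assms] .
  show "(\<lambda>y. \<Sum>k\<in>UNIV. c (\<pi> (fst y)) (z k) * indicator {y. snd y = z k} y) \<in> borel_measurable D"
    by measurable
qed

text \<open>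
  Pulling the function of the feature vector out of the conditional expectation replaces the
  indicators of the scenarios by the conditional probabilities.
\<close>

lemma risk_eq_expected_cost:
  fixes c :: "'w \<Rightarrow> 'z \<Rightarrow> real"
  assumes fstar: "true_hypothesis X D z fstar"
    and meas: "\<And>k. (\<lambda>x. c (\<pi> x) (z k)) \<in> borel_measurable feature_space"
    and bound: "\<And>x k. x \<in> X \<Longrightarrow> \<bar>c (\<pi> x) (z k)\<bar> \<le> B"
  shows "integrable (marginal X D) (\<lambda>x. expected_cost c z (fstar x) (\<pi> x))"
    and "risk D c \<pi> = (\<integral>x. expected_cost c z (fstar x) (\<pi> x) \<partial>marginal X D)"
proof -
  let ?F = "vimage_algebra (space D) fst feature_space"
  let ?I = "\<lambda>k. indicator {y. snd y = z k} :: 'x \<times> 'z \<Rightarrow> real"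
  have fsp: "fst \<in> space D \<rightarrow> space feature_space"
    using measurable_space[OF fst_measurable] by auto
  have "subalgebra D ?F"
    unfolding subalgebra_def using sets_image_in_sets[OF refl fst_measurable] by simp
  then interpret finite_measure_subalgebra D ?F
    by unfold_locales
  have fstar': "fstar \<in> X \<rightarrow>\<^sub>E prob_simplex" "fstar \<in> borel_measurable feature_space"
    and cond: "\<And>k. AE y in D. fstar (fst y) $ k = real_cond_exp D ?F (?I k) y"
    using fstar by (auto simp: true_hypothesis_def)
  have [measurable]: "(\<lambda>x. fstar x $ k) \<in> borel_measurable feature_space" for k
    by (rule measurable_compose[OF fstar'(2)])
       (intro borel_measurable_continuous_onI continuous_intros)
  note [measurable] = meas
  have ec[measurable]: "(\<lambda>x. expected_cost c z (fstar x) (\<pi> x)) \<in> borel_measurable feature_space"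
    unfolding expected_cost_def by measurable
  have measD[measurable]: "(\<lambda>y. c (\<pi> (fst y)) (z k)) \<in> borel_measurable D" for k
    using measurable_compose[OF fst_measurable meas] .
  \<comment> \<open>Measurability with respect to the sigma-algebra generated by the features is
    what allows the factor to be pulled out of the conditional expectation.\<close>
  have measF: "(\<lambda>y. c (\<pi> (fst y)) (z k)) \<in> borel_measurable ?F" for k
    using measurable_compose[OF measurable_vimage_algebra1[OF fsp] meas] .
  have int: "integrable D (\<lambda>y. c (\<pi> (fst y)) (z k) * ?I k y)" for k
  proof (rule integrable_const_bound)
    show "AE y in D. norm (c (\<pi> (fst y)) (z k) * ?I k y) \<le> \<bar>B\<bar>"
    proof (rule AE_I2)
      fix y assume "y \<in> space D"
      then have "\<bar>c (\<pi> (fst y)) (z k)\<bar> \<le> B"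
        using bound space_D by auto
      then show "norm (c (\<pi> (fst y)) (z k) * ?I k y) \<le> \<bar>B\<bar>"
        by (auto simp: indicator_def)
    qed
  qed measurable
  have intfm: "integrable D (\<lambda>y. c (\<pi> (fst y)) (z k) * fstar (fst y) $ k)"
    and eq: "(\<integral>y. c (\<pi> (fst y)) (z k) * ?I k y \<partial>D) = (\<integral>y. c (\<pi> (fst y)) (z k) * fstar (fst y) $ k \<partial>D)"
    for k
  proof -
    note ce = real_cond_exp_intg[OF int measF scenario_measurable, of k]
    \<comment> \<open>\<open>fstar\<close> agrees with the conditional expectations only almost
      everywhere, which is enough under the integral.\<close>
    have ae: "AE y in D. c (\<pi> (fst y)) (z k) * real_cond_exp D ?F (?I k) y =
        c (\<pi> (fst y)) (z k) * fstar (fst y) $ k"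
      using cond[of k] by eventually_elim simp
    show "integrable D (\<lambda>y. c (\<pi> (fst y)) (z k) * fstar (fst y) $ k)"
      by (rule Bochner_Integration.integrable_cong_AE_imp[OF ce(1)]) (use ae in \<open>auto elim!: eventually_mono\<close>)
    have "(\<integral>y. c (\<pi> (fst y)) (z k) * real_cond_exp D ?F (?I k) y \<partial>D) =
        (\<integral>y. c (\<pi> (fst y)) (z k) * fstar (fst y) $ k \<partial>D)"
      by (rule integral_cong_AE) (use ae in \<open>auto\<close>)
    with ce(2) show "(\<integral>y. c (\<pi> (fst y)) (z k) * ?I k y \<partial>D) = (\<integral>y. c (\<pi> (fst y)) (z k) * fstar (fst y) $ k \<partial>D)"
      by simp
  qed
  have ec_eq: "expected_cost c z (fstar x) (\<pi> x) = (\<Sum>k\<in>UNIV. c (\<pi> x) (z k) * fstar x $ k)" for x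
    unfolding expected_cost_def by (simp add: mult.commute)
  have "integrable D (\<lambda>y. expected_cost c z (fstar (fst y)) (\<pi> (fst y)))"
    unfolding ec_eq by (intro Bochner_Integration.integrable_sum intfm)
  then show "integrable (marginal X D) (\<lambda>x. expected_cost c z (fstar x) (\<pi> x))"
    unfolding marginal_def by (subst integrable_distr_eq) (auto intro: ec)
  have "risk D c \<pi> = (\<integral>y. (\<Sum>k\<in>UNIV. c (\<pi> (fst y)) (z k) * ?I k y) \<partial>D)"
    unfolding risk_def by (rule Bochner_Integration.integral_cong[OF refl cost_decomposition])
  also have "\<dots> = (\<integral>y. expected_cost c z (fstar (fst y)) (\<pi> (fst y)) \<partial>D)"
    unfolding ec_eq Bochner_Integration.integral_sum[OF int]
      Bochner_Integration.integral_sum[OF intfm] eq ..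
  also have "\<dots> = (\<integral>x. expected_cost c z (fstar x) (\<pi> x) \<partial>marginal X D)"
    unfolding marginal_def by (rule integral_distr[symmetric]) (auto intro: ec)
  finally show "risk D c \<pi> = (\<integral>x. expected_cost c z (fstar x) (\<pi> x) \<partial>marginal X D)" .
qed

text \<open>At every feature \<open>\<pi>' x\<close> minimizes the expected cost under
  \<open>fstar x\<close>, and integration preserves the comparison. When the risks agree, the
  nonnegative difference of the integrands has integral 0, so it vanishes almost everywhere and
  \<open>\<pi> x\<close> is optimal there as well.\<close>

lemma true_hypothesis_minimizes_risk:
  fixes c :: "'w \<Rightarrow> 'z \<Rightarrow> real"
  assumes fstar: "true_hypothesis X D z fstar"
    and meas: "\<And>k. (\<lambda>x. c (\<pi> x) (z k)) \<in> borel_measurable feature_space"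
      "\<And>k. (\<lambda>x. c (\<pi>' x) (z k)) \<in> borel_measurable feature_space"
    and bound: "\<And>v k. v \<in> S \<Longrightarrow> \<bar>c v (z k)\<bar> \<le> B"
    and opt: "\<And>x. x \<in> X \<Longrightarrow> \<pi>' x \<in> opt_set S c z (fstar x)"
    and S: "\<And>x. x \<in> X \<Longrightarrow> \<pi> x \<in> S"
  shows "risk D c \<pi>' \<le> risk D c \<pi>"
    and "risk D c \<pi> = risk D c \<pi>' \<Longrightarrow> AE x in marginal X D. \<pi> x \<in> opt_set S c z (fstar x)"
proof -
  have sp: "space (marginal X D) = X"
    by (simp add: marginal_def space_restrict_space)
  have S': "\<pi>' x \<in> S" if "x \<in> X" for x
    using opt[OF that] by (auto simp: opt_set_def is_arg_min_def)
  have bound': "\<bar>c (\<pi> x) (z k)\<bar> \<le> B" "\<bar>c (\<pi>' x) (z k)\<bar> \<le> B" if "x \<in> X" for x k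
    using bound S[OF that] S'[OF that] by auto
  note r = risk_eq_expected_cost[where c = c and \<pi> = \<pi>, OF fstar meas(1) bound'(1)]
    and r' = risk_eq_expected_cost[where c = c and \<pi> = \<pi>', OF fstar meas(2) bound'(2)]
  have le: "expected_cost c z (fstar x) (\<pi>' x) \<le> expected_cost c z (fstar x) v"
    if "x \<in> X" "v \<in> S" for x v
    using opt[OF that(1)] that(2) by (auto simp: opt_set_def is_arg_min_linorder)
  show "risk D c \<pi>' \<le> risk D c \<pi>"
    using integral_mono[OF r'(1) r(1)] le S sp r(2) r'(2) by simp
  assume eq: "risk D c \<pi> = risk D c \<pi>'"
  let ?d = "\<lambda>x. expected_cost c z (fstar x) (\<pi> x) - expected_cost c z (fstar x) (\<pi>' x)"
  have "(\<integral>x. ?d x \<partial>marginal X D) = 0"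
    using eq r r' by simp
  moreover have "AE x in marginal X D. 0 \<le> ?d x"
    by (rule AE_I2) (use le S sp in auto)
  ultimately have "AE x in marginal X D. ?d x = 0"
    using integral_nonneg_eq_0_iff_AE[of "marginal X D" ?d] r(1) r'(1) by simp
  then show "AE x in marginal X D. \<pi> x \<in> opt_set S c z (fstar x)"
  proof (rule AE_mp, intro AE_I2 impI)
    fix x assume x: "x \<in> space (marginal X D)" and "?d x = 0"
    then show "\<pi> x \<in> opt_set S c z (fstar x)"
      using le[of x] S[of x] sp unfolding opt_set_def by (simp add: is_arg_min_linorder)
  qed
qed

end

section \<open>Consistency of regularized empirical risk minimization\<close>

text \<open>Identifiability enters the second part as uniqueness of \<open>fstar\<close>.
  Convergence of the hypotheses and of the decisions at all features is obtained on one common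
  event, from which the separate almost sure statements can be read off.\<close>

lemma (in finite_scenarios) regularized_erm_consistency:
  fixes S :: "(real ^ 'd) set"
    and N :: "real ^ 'd \<Rightarrow> real"
    and NK NL :: "real ^ 'k \<Rightarrow> real"
    and c :: "real ^ 'd \<Rightarrow> 'z \<Rightarrow> real"
    and \<phi> :: "real ^ 'd \<Rightarrow> real"
    and H :: "('x \<Rightarrow> real ^ 'k) set"
    and M :: "'a measure"
    and Z :: "nat \<Rightarrow> 'a \<Rightarrow> 'x \<times> 'z"
    and \<rho> :: "nat \<Rightarrow> real"
  defines "u \<equiv> reg_opt S c z \<phi>"
  assumes S: "S \<noteq> {}" "compact S"
    and norms: "is_norm N" "is_norm NK" "is_norm NL"
    and c: "\<And>k. continuous_on S (\<lambda>v. c v (z k))"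
    and \<phi>: "\<And>v. v \<in> S \<Longrightarrow> 0 \<le> \<phi> v" "continuous_on S \<phi>"
    and H: "H \<subseteq> X \<rightarrow>\<^sub>E prob_simplex"
      "\<And>f. f \<in> H \<Longrightarrow> f \<in> borel_measurable feature_space"
      "compact_space (Metric_space.mtopology H (sup_dist NK X))"
    and fstar: "true_hypothesis X D z fstar" "fstar \<in> H"
    and w: "\<And>p. p \<in> prob_simplex \<Longrightarrow> w p \<in> opt_set S c z p"
      "\<And>f. f \<in> H \<Longrightarrow> w \<circ> f \<in> borel_measurable feature_space"
    and sample: "prob_space M"
      "prob_space.indep_vars M (\<lambda>_. D) Z {1..}"
      "\<And>i. i \<ge> 1 \<Longrightarrow> distr M D (Z i) = D"
    and \<rho>: "\<rho>max > 0" "\<And>n. n \<ge> 1 \<Longrightarrow> \<rho> n \<in> {0<..\<rho>max}" "\<rho> \<longlonglongrightarrow> 0"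
    and fhat: "\<And>n \<omega>. n \<ge> 1 \<Longrightarrow> \<omega> \<in> space M \<Longrightarrow>
      is_arg_min (\<lambda>f. emp_risk c (\<lambda>i. Z i \<omega>) n (u (\<rho> n) \<circ> f)) (\<lambda>f. f \<in> H) (fhat n \<omega>)"
    and A2A: "\<And>p r s. p \<in> prob_simplex \<Longrightarrow> r \<in> {0<..\<rho>max} \<Longrightarrow> s \<in> {0<..\<rho>max} \<Longrightarrow>
      N (u r p - u s p) \<le> L\<rho> * \<bar>r - s\<bar>"
    and A2B: "\<And>r p q. r \<in> {0<..\<rho>max} \<Longrightarrow> p \<in> prob_simplex \<Longrightarrow> q \<in> prob_simplex \<Longrightarrow>
      N (u r p - u r q) \<le> Lw * NL (p - q)"
  shows "AE \<omega> in M.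
      (\<lambda>n. min_over (\<lambda>f. emp_risk c (\<lambda>i. Z i \<omega>) n (u (\<rho> n) \<circ> f)) H)
        \<longlonglongrightarrow> min_over (\<lambda>f. risk D c (w \<circ> f)) H"
    and "(\<And>f. f \<in> H \<Longrightarrow>
          AE x in marginal X D. opt_set S c z (f x) \<inter> opt_set S c z (fstar x) \<noteq> {} \<Longrightarrow> f = fstar) \<Longrightarrow>
      AE \<omega> in M. (\<lambda>n. sup_dist NK X (fhat n \<omega>) fstar) \<longlonglongrightarrow> 0
        \<and> (\<forall>x\<in>X. (\<lambda>n. dist_to N (u (\<rho> n) (fhat n \<omega> x)) (opt_set S c z (fstar x))) \<longlonglongrightarrow> 0)"
proof -
  interpret M: prob_space M by (fact sample(1))
  obtain BN where BN: "BN > 0" "\<And>v. N v \<le> BN * norm v"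
    using is_norm_le_norm[OF norms(1)] by blast
  obtain bN where bN: "bN > 0" "\<And>v. norm v \<le> bN * N v"
    using norm_le_is_norm[OF norms(1)] by blast
  obtain BK where BK: "BK > 0" "\<And>v. NK v \<le> BK * norm v"
    using is_norm_le_norm[OF norms(2)] by blast
  obtain bK where bK: "bK > 0" "\<And>v. norm v \<le> bK * NK v"
    using norm_le_is_norm[OF norms(2)] by blast
  obtain BL where BL: "BL > 0" "\<And>v. NL v \<le> BL * norm v"
    using is_norm_le_norm[OF norms(3)] by blast
  have NL0: "NL v \<ge> 0" and NK0: "NK v' \<ge> 0" and N0: "N v'' \<ge> 0" for v v' v''
    using norms by (auto simp: is_norm_def)
  \<comment> \<open>\<open>bN\<close> and \<open>BL\<close> translate the given norms into Euclidean
    ones; the absolute values make both constants nonnegative whatever the signs of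
    \<open>L\<rho>\<close> and \<open>Lw\<close>.\<close>
  define A where "A = bN * \<bar>L\<rho>\<bar>"
  define L where "L = bN * \<bar>Lw\<bar> * BL"
  have A0: "A \<ge> 0" and L0: "L \<ge> 0"
    using bN BL by (auto simp: A_def L_def)
  have lip_r: "norm (u r p - u s p) \<le> A * \<bar>r - s\<bar>"
    if "p \<in> prob_simplex" "r \<in> {0<..\<rho>max}" "s \<in> {0<..\<rho>max}" for p r s
  proof -
    have "N (u r p - u s p) \<le> \<bar>L\<rho>\<bar> * \<bar>r - s\<bar>"
      using A2A[OF that] by (rule order_trans) (intro mult_right_mono, auto)
    then have "bN * N (u r p - u s p) \<le> bN * (\<bar>L\<rho>\<bar> * \<bar>r - s\<bar>)"
      using bN(1) by (intro mult_left_mono) auto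
    then show ?thesis
      using bN(2)[of "u r p - u s p"] unfolding A_def by (simp add: mult.assoc)
  qed
  have lip_p: "norm (u r p - u r q) \<le> L * norm (p - q)"
    if "p \<in> prob_simplex" "q \<in> prob_simplex" "r \<in> {0<..\<rho>max}" for p q r
  proof -
    have "N (u r p - u r q) \<le> \<bar>Lw\<bar> * NL (p - q)"
      using A2B[OF that(3,1,2)] by (rule order_trans) (intro mult_right_mono NL0, auto)
    also have "\<dots> \<le> \<bar>Lw\<bar> * (BL * norm (p - q))"
      by (intro mult_left_mono BL) auto
    finally have "bN * N (u r p - u r q) \<le> bN * (\<bar>Lw\<bar> * (BL * norm (p - q)))"
      using bN(1) by (intro mult_left_mono) auto
    then show ?thesis
      using bN(2)[of "u r p - u r q"] unfolding L_def by (simp add: mult.assoc)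
  qed
  obtain w0 where w0: "\<And>p r. p \<in> prob_simplex \<Longrightarrow> r \<in> {0<..\<rho>max} \<Longrightarrow> norm (u r p - w0 p) \<le> A * r"
    "\<And>p q. p \<in> prob_simplex \<Longrightarrow> q \<in> prob_simplex \<Longrightarrow> norm (w0 p - w0 q) \<le> L * norm (p - q)"
    "\<And>p. p \<in> prob_simplex \<Longrightarrow> w0 p \<in> opt_set S c z p"
  proof (rule vanishing_regularization[where c = c and z = z and A = A and L = L,
        OF S c \<phi>(2) _ \<rho>(1), folded u_def])
    show "0 \<le> \<phi> v" if "v \<in> S" for v
      by (rule \<phi>(1)[OF that])
  qed (use A0 lip_r lip_p in auto)
  have uS: "u r p \<in> S" for r p
    using reg_opt_is_arg_min[where c = c and z = z, OF S c \<phi>(2)] by (auto simp: u_def is_arg_min_def)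
  have w0S: "w0 p \<in> S" and wS: "w p \<in> S" if "p \<in> prob_simplex" for p
    using w0(3)[OF that] w(1)[OF that] by (auto simp: opt_set_def is_arg_min_def)
  have HD: "f x \<in> prob_simplex" if "f \<in> H" "x \<in> X" for f x
    using H(1) that by (auto simp: PiE_def Pi_def)
  obtain B where B: "\<And>v k. v \<in> S \<Longrightarrow> \<bar>c v (z k)\<bar> \<le> B"
    and equi: "\<And>\<epsilon>. \<epsilon> > 0 \<Longrightarrow>
      \<exists>\<delta>>0. \<forall>u\<in>S. \<forall>v\<in>S. \<forall>k. dist u v < \<delta> \<longrightarrow> \<bar>c u (z k) - c v (z k)\<bar> \<le> \<epsilon>"
    using compact_uniformly_bounded_equicontinuous[where c = c and z = z, OF S(2) c] by blast

  \<comment> \<open>The costs are continuous only on \<open>S\<close>, so a policy is regarded as a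
    measurable map into the Borel space restricted to \<open>S\<close>.\<close>
  have cost_meas: "(\<lambda>x. c (\<pi> x) (z k)) \<in> borel_measurable feature_space"
    if "\<pi> \<in> borel_measurable feature_space" "\<And>x. x \<in> X \<Longrightarrow> \<pi> x \<in> S" for \<pi> k
  proof -
    have "\<pi> \<in> feature_space \<rightarrow>\<^sub>M restrict_space borel S"
      using that by (intro measurable_restrict_space2) (auto simp: space_restrict_space)
    from measurable_compose[OF this borel_measurable_continuous_on_restrict[OF c]] show ?thesis .
  qed
  \<comment> \<open>The limit selection is Lipschitz on the simplex, hence Borel there.\<close>
  have w0_meas: "w0 \<circ> f \<in> borel_measurable feature_space" if f: "f \<in> H" for f
  proof -
    have "L-lipschitz_on prob_simplex w0"
      using w0(2) L0 by (auto intro!: lipschitz_onI simp: dist_norm)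
    then have "w0 \<in> borel_measurable (restrict_space borel prob_simplex)"
      by (intro borel_measurable_continuous_on_restrict lipschitz_on_continuous_on)
    moreover have "f \<in> feature_space \<rightarrow>\<^sub>M restrict_space borel prob_simplex"
      using H(2)[OF f] HD[OF f] by (intro measurable_restrict_space2) (auto simp: space_restrict_space)
    ultimately show ?thesis
      by (rule measurable_comp[rotated])
  qed
  have c_w0_meas: "(\<lambda>x. c ((w0 \<circ> f) x) (z k)) \<in> borel_measurable feature_space" if "f \<in> H" for f k
    by (rule cost_meas[OF w0_meas[OF that]]) (simp add: w0S HD that)
  \<comment> \<open>Two selections \<open>v\<close> and \<open>v'\<close> are allowed because
    \<open>w\<close> and \<open>w0\<close> are compared with themselves and with each other.\<close>
  have le_risk: "risk D c (v' \<circ> fstar) \<le> risk D c (v \<circ> f)"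
    and eq_risk: "risk D c (v \<circ> f) = risk D c (v' \<circ> fstar) \<Longrightarrow>
      AE x in marginal X D. (v \<circ> f) x \<in> opt_set S c z (fstar x)"
    if f: "f \<in> H" and meas: "v \<circ> f \<in> borel_measurable feature_space" "v' \<circ> fstar \<in> borel_measurable feature_space"
      and v: "\<And>p. p \<in> prob_simplex \<Longrightarrow> v p \<in> S" "\<And>p. p \<in> prob_simplex \<Longrightarrow> v' p \<in> opt_set S c z p"
    for f v v'
  proof -
    have v'S: "v' p \<in> S" if "p \<in> prob_simplex" for p
      using v(2)[OF that] by (auto simp: opt_set_def is_arg_min_def)
    have cm: "(\<lambda>x. c ((v \<circ> f) x) (z k)) \<in> borel_measurable feature_space" for k
      by (rule cost_meas[OF meas(1)]) (simp add: v HD f)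
    have cm': "(\<lambda>x. c ((v' \<circ> fstar) x) (z k)) \<in> borel_measurable feature_space" for k
      by (rule cost_meas[OF meas(2)]) (simp add: v'S HD fstar(2))
    note * = true_hypothesis_minimizes_risk[where c = c and \<pi> = "v \<circ> f" and \<pi>' = "v' \<circ> fstar",
        OF fstar(1) cm cm' B]
    show "risk D c (v' \<circ> fstar) \<le> risk D c (v \<circ> f)"
      by (rule *(1)) (auto intro!: v HD f fstar(2))
    show "AE x in marginal X D. (v \<circ> f) x \<in> opt_set S c z (fstar x)"
      if "risk D c (v \<circ> f) = risk D c (v' \<circ> fstar)"
      by (rule *(2)[OF _ _ _ that]) (auto intro!: v HD f fstar(2))
  qed
  have le_w: "risk D c (w \<circ> fstar) \<le> risk D c (w \<circ> f)"
    and le_w0: "risk D c (w0 \<circ> fstar) \<le> risk D c (w0 \<circ> f)"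
    and eq_w0: "risk D c (w0 \<circ> f) = risk D c (w0 \<circ> fstar) \<Longrightarrow>
      AE x in marginal X D. (w0 \<circ> f) x \<in> opt_set S c z (fstar x)" if f: "f \<in> H" for f
    using le_risk[OF f w(2)[OF f] w(2)[OF fstar(2)] wS w(1)]
      le_risk[OF f w0_meas[OF f] w0_meas[OF fstar(2)] w0S w0(3)]
      eq_risk[OF f w0_meas[OF f] w0_meas[OF fstar(2)] w0S w0(3)] by auto
  \<comment> \<open>At \<open>fstar\<close> both selections are optimal for the true conditional
    probabilities, so each policy has at most the risk of the other.\<close>
  have w_eq_w0: "risk D c (w \<circ> fstar) = risk D c (w0 \<circ> fstar)"
    using le_risk[OF fstar(2) w0_meas[OF fstar(2)] w(2)[OF fstar(2)] w0S w(1)]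
      le_risk[OF fstar(2) w(2)[OF fstar(2)] w0_meas[OF fstar(2)] wS w0(3)] by (rule antisym)
  have min_w: "min_over (\<lambda>f. risk D c (w \<circ> f)) H = risk D c (w0 \<circ> fstar)"
    unfolding w_eq_w0[symmetric]
    by (rule min_over_arg_min) (use le_w fstar(2) in \<open>auto simp: is_arg_min_linorder\<close>)
  have min_w0: "is_arg_min (\<lambda>f. risk D c (w0 \<circ> f)) (\<lambda>f. f \<in> H) fstar"
    using le_w0 fstar(2) by (auto simp: is_arg_min_linorder)

  have NK_le: "NK (f x) \<le> BK" if "f \<in> H" "x \<in> X" for f x
  proof -
    have "BK * norm (f x) \<le> BK * 1"
      using BK(1) norm_prob_simplex_le[OF HD[OF that]] by (intro mult_left_mono) auto
    then show ?thesis
      using BK(2)[of "f x"] by simp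
  qed
  interpret H: Metric_space H "sup_dist NK X"
    by (rule Metric_space_sup_dist[where B = BK])
       (use H(1) norms(2) NK_le in \<open>auto simp: PiE_def\<close>)
  have sup_dist: "norm (f x - g x) \<le> bK * sup_dist NK X f g" if "f \<in> H" "g \<in> H" "x \<in> X" for f g x
  proof -
    have "NK (f x - g x) \<le> sup_dist NK X f g"
    proof (rule sup_dist_upper[OF _ that(3)])
      show "NK (f x - g x) \<le> BK * 2" if "x \<in> X" for x
      proof -
        have "norm (f x - g x) \<le> 2"
          using norm_triangle_ineq4[of "f x" "g x"] norm_prob_simplex_le[OF HD[OF \<open>f \<in> H\<close> that]]
            norm_prob_simplex_le[OF HD[OF \<open>g \<in> H\<close> that]] by linarith
        then have "BK * norm (f x - g x) \<le> BK * 2"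
          using BK(1) by (intro mult_left_mono) auto
        then show ?thesis
          using BK(2)[of "f x - g x"] by linarith
      qed
    qed (rule NK0)
    then have "bK * NK (f x - g x) \<le> bK * sup_dist NK X f g"
      using bK(1) by (intro mult_left_mono) auto
    then show ?thesis
      using bK(2)[of "f x - g x"] by linarith
  qed

  define h where "h f y = c ((w0 \<circ> f) (fst y)) (snd y)" for f :: "'x \<Rightarrow> real ^ 'k" and y
  have h_risk: "(\<integral>y. h f y \<partial>D) = risk D c (w0 \<circ> f)" for f
    by (simp add: h_def risk_def)
  have h_meas: "h f \<in> borel_measurable D" if "f \<in> H" for f
    unfolding h_def[abs_def] by (rule cost_measurable[where c = c and \<pi> = "w0 \<circ> f", OF c_w0_meas[OF that]])
  have h_bound: "\<bar>h f y\<bar> \<le> B" if "f \<in> H" "y \<in> space D" for f y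
    using that space_D by (auto simp: h_def intro!: B w0S HD)
  have h_int: "integrable D (h f)" if "f \<in> H" for f
    by (rule integrable_const_bound[where B = B]) (use that h_meas h_bound in auto)
  have h_modulus: "\<exists>\<delta>>0. \<forall>f\<in>H. \<forall>g\<in>H. sup_dist NK X f g < \<delta> \<longrightarrow> (\<forall>y\<in>space D. \<bar>h f y - h g y\<bar> \<le> \<epsilon>)"
    if "\<epsilon> > 0" for \<epsilon>
  proof -
    obtain \<delta> where \<delta>: "\<delta> > 0"
      "\<And>u v k. u \<in> S \<Longrightarrow> v \<in> S \<Longrightarrow> dist u v < \<delta> \<Longrightarrow> \<bar>c u (z k) - c v (z k)\<bar> \<le> \<epsilon>"
      using equi[OF \<open>\<epsilon> > 0\<close>] by blast
    \<comment> \<open>\<open>L * bK\<close> is the Lipschitz factor from the sup-norm distance to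
      the decisions; the added 1 keeps the divisor positive when \<open>L\<close> is 0.\<close>
    define \<eta> where "\<eta> = \<delta> / (L * bK + 1)"
    have pos: "L * bK + 1 > 0"
      using L0 bK(1) by (simp add: add_nonneg_pos)
    have "\<bar>h f y - h g y\<bar> \<le> \<epsilon>" if fg: "f \<in> H" "g \<in> H" "sup_dist NK X f g < \<eta>" and y: "y \<in> space D" for f g y
    proof -
      obtain k where x: "fst y \<in> X" and k: "snd y = z k"
        using y space_D by auto
      have "dist (w0 (f (fst y))) (w0 (g (fst y))) \<le> L * norm (f (fst y) - g (fst y))"
        unfolding dist_norm by (intro w0 HD fg x)
      also have "\<dots> \<le> L * (bK * sup_dist NK X f g)"
        by (intro mult_left_mono sup_dist fg x L0)
      also have "\<dots> \<le> (L * bK + 1) * sup_dist NK X f g"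
        by (simp add: algebra_simps)
      also have "\<dots> < \<delta>"
        using fg(3) pos unfolding \<eta>_def by (simp add: field_simps)
      finally show ?thesis
        unfolding h_def k by (simp, intro \<delta>(2) w0S HD fg x)
    qed
    moreover have "\<eta> > 0"
      using \<delta>(1) pos by (simp add: \<eta>_def)
    ultimately show ?thesis
      by blast
  qed
  have net: "\<exists>F. finite F \<and> F \<subseteq> H \<and> (\<forall>f\<in>H. \<exists>g\<in>F. \<forall>y\<in>space D. \<bar>h f y - h g y\<bar> \<le> \<epsilon>)"
    if "\<epsilon> > 0" for \<epsilon>
  proof -
    obtain \<delta> where \<delta>: "\<delta> > 0" "\<And>f g y. f \<in> H \<Longrightarrow> g \<in> H \<Longrightarrow> sup_dist NK X f g < \<delta> \<Longrightarrow>
        y \<in> space D \<Longrightarrow> \<bar>h f y - h g y\<bar> \<le> \<epsilon>"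
      using h_modulus[OF \<open>\<epsilon> > 0\<close>] by blast
    \<comment> \<open>Compactness gives total boundedness, and the centres of a finite cover by
      balls of radius \<delta> form the net.\<close>
    have "H.mtotally_bounded H"
      using H(3) unfolding H.compact_space_eq_mcomplete_mtotally_bounded by (rule conjunct2)
    then have "\<exists>F. finite F \<and> F \<subseteq> H \<and> H \<subseteq> (\<Union>g\<in>F. H.mball g \<delta>)"
      unfolding H.mtotally_bounded_def using \<delta>(1) by (elim allE impE)
    then obtain F where F: "finite F" "F \<subseteq> H" "H \<subseteq> (\<Union>g\<in>F. H.mball g \<delta>)"
      by (elim exE conjE)
    have "\<exists>g\<in>F. \<forall>y\<in>space D. \<bar>h f y - h g y\<bar> \<le> \<epsilon>" if f: "f \<in> H" for f
    proof -
      obtain g where g: "g \<in> F" "f \<in> H.mball g \<delta>"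
        using F(3) f by blast
      then have "g \<in> H" "sup_dist NK X f g < \<delta>"
        using H.commute[of f g] by (auto simp only: H.in_mball)
      then show ?thesis
        using \<delta>(2)[OF f] by (intro bexI[OF _ g(1)] ballI)
    qed
    then show ?thesis
      using F by blast
  qed

  have Z: "Z i \<in> M \<rightarrow>\<^sub>M D" if "i \<ge> 1" for i
    using sample(2) that by (auto simp: M.indep_vars_def)
  have ev_\<rho>: "\<forall>\<^sub>F n in sequentially. \<rho> n \<in> {0<..\<rho>max} \<and> A * \<rho> n < \<delta>" if "\<delta> > 0" for \<delta>
  proof -
    have "(\<lambda>n. A * \<rho> n) \<longlonglongrightarrow> 0"
      using tendsto_mult_right_zero[OF \<rho>(3)] .
    then have "\<forall>\<^sub>F n in sequentially. A * \<rho> n < \<delta>"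
      using that by (rule order_tendstoD)
    then show ?thesis
      using eventually_ge_at_top[of 1] by eventually_elim (use \<rho>(2) in blast)
  qed
  have "AE \<omega> in M. \<forall>\<epsilon>>0. \<forall>\<^sub>F n in sequentially. \<forall>f\<in>H.
      \<bar>(\<Sum>i=1..n. h f (Z i \<omega>)) / real n - (\<integral>y. h f y \<partial>D)\<bar> \<le> \<epsilon>"
    by (rule M.uniform_strong_law[OF sample(2,3) h_meas h_bound net])
  \<comment> \<open>Half of \<epsilon> covers the uniform law for \<open>w0\<close>; the other half
    covers replacing \<open>w0\<close> by \<open>u (\<rho> n)\<close>, whose distance at every
    sample point is at most \<open>A * \<rho> n\<close>.\<close>
  then have unif: "AE \<omega> in M. \<forall>\<epsilon>>0. \<forall>\<^sub>F n in sequentially. \<forall>f\<in>H.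
      \<bar>emp_risk c (\<lambda>i. Z i \<omega>) n (u (\<rho> n) \<circ> f) - risk D c (w0 \<circ> f)\<bar> \<le> \<epsilon>"
  proof (rule AE_mp, intro AE_I2 impI allI)
    fix \<omega> \<epsilon> assume \<omega>: "\<omega> \<in> space M" and "(\<epsilon>::real) > 0" and law: "\<forall>\<epsilon>>0. \<forall>\<^sub>F n in sequentially. \<forall>f\<in>H.
      \<bar>(\<Sum>i=1..n. h f (Z i \<omega>)) / real n - (\<integral>y. h f y \<partial>D)\<bar> \<le> \<epsilon>"
    then have e2: "\<epsilon> / 2 > 0" by simp
    obtain \<delta> where \<delta>: "\<delta> > 0"
      "\<And>u v k. u \<in> S \<Longrightarrow> v \<in> S \<Longrightarrow> dist u v < \<delta> \<Longrightarrow> \<bar>c u (z k) - c v (z k)\<bar> \<le> \<epsilon> / 2"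
      using equi[OF e2] by blast
    from law[rule_format, OF e2] ev_\<rho>[OF \<delta>(1)]
    show "\<forall>\<^sub>F n in sequentially. \<forall>f\<in>H.
      \<bar>emp_risk c (\<lambda>i. Z i \<omega>) n (u (\<rho> n) \<circ> f) - risk D c (w0 \<circ> f)\<bar> \<le> \<epsilon>"
    proof eventually_elim
      case (elim n)
      show ?case
      proof
        fix f assume f: "f \<in> H"
        have close: "\<bar>c (u (\<rho> n) (f (fst (Z i \<omega>)))) (snd (Z i \<omega>)) - h f (Z i \<omega>)\<bar> \<le> \<epsilon> / 2"
          if "i \<in> {1..n}" for i
        proof -
          have "Z i \<omega> \<in> space D"
            using Z[of i] that \<omega> by (auto dest: measurable_space)
          then obtain k where x: "fst (Z i \<omega>) \<in> X" and k: "snd (Z i \<omega>) = z k"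
            using space_D by auto
          have "dist (u (\<rho> n) (f (fst (Z i \<omega>)))) (w0 (f (fst (Z i \<omega>)))) \<le> A * \<rho> n"
            unfolding dist_norm by (intro w0 HD f x) (use elim in simp)
          then have "dist (u (\<rho> n) (f (fst (Z i \<omega>)))) (w0 (f (fst (Z i \<omega>)))) < \<delta>"
            using elim by linarith
          from \<delta>(2)[OF uS w0S[OF HD[OF f x]] this] show ?thesis
            by (simp add: h_def k)
        qed
        have "\<bar>(\<Sum>i=1..n. c (u (\<rho> n) (f (fst (Z i \<omega>)))) (snd (Z i \<omega>))) - (\<Sum>i=1..n. h f (Z i \<omega>))\<bar>
            \<le> (\<Sum>i=1..n. \<epsilon> / 2)"
          unfolding sum_subtractf[symmetric] by (rule order_trans[OF sum_abs], intro sum_mono close)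
        then have "\<bar>emp_risk c (\<lambda>i. Z i \<omega>) n (u (\<rho> n) \<circ> f) - (\<Sum>i=1..n. h f (Z i \<omega>)) / real n\<bar> \<le> \<epsilon> / 2"
          using e2 unfolding emp_risk_def
          by (cases "n = 0") (simp_all flip: diff_divide_distrib add: field_simps)
        then show "\<bar>emp_risk c (\<lambda>i. Z i \<omega>) n (u (\<rho> n) \<circ> f) - risk D c (w0 \<circ> f)\<bar> \<le> \<epsilon>"
          using elim(1)[rule_format, OF f] unfolding h_risk by linarith
      qed
    qed
  qed
  have ev_fhat: "\<forall>\<^sub>F n in sequentially.
      is_arg_min (\<lambda>f. emp_risk c (\<lambda>i. Z i \<omega>) n (u (\<rho> n) \<circ> f)) (\<lambda>f. f \<in> H) (fhat n \<omega>)"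
    if "\<omega> \<in> space M" for \<omega>
    using eventually_ge_at_top[of 1] by eventually_elim (rule fhat[OF _ that])
  show "AE \<omega> in M.
      (\<lambda>n. min_over (\<lambda>f. emp_risk c (\<lambda>i. Z i \<omega>) n (u (\<rho> n) \<circ> f)) H)
        \<longlonglongrightarrow> min_over (\<lambda>f. risk D c (w \<circ> f)) H"
    using unif unfolding min_w
    by (rule AE_mp, intro AE_I2 impI)
       (rule uniform_convergence_arg_min[OF _ ev_fhat min_w0], auto)

  assume ident: "\<And>f. f \<in> H \<Longrightarrow>
    AE x in marginal X D. opt_set S c z (f x) \<inter> opt_set S c z (fstar x) \<noteq> {} \<Longrightarrow> f = fstar"
  \<comment> \<open>Equal risk would make \<open>w0 (f x)\<close> optimal for \<open>fstar x\<close>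
    almost everywhere. It is always optimal for \<open>f x\<close>, so the two optimal sets would
    meet and identifiability would force \<open>f = fstar\<close>.\<close>
  have strict: "risk D c (w0 \<circ> fstar) < risk D c (w0 \<circ> f)" if f: "f \<in> H" "f \<noteq> fstar" for f
  proof (rule ccontr)
    assume "\<not> ?thesis"
    then have "risk D c (w0 \<circ> f) = risk D c (w0 \<circ> fstar)"
      using le_w0[OF f(1)] by simp
    from eq_w0[OF f(1) this]
    have "AE x in marginal X D. opt_set S c z (f x) \<inter> opt_set S c z (fstar x) \<noteq> {}"
    proof (rule AE_mp, intro AE_I2 impI)
      fix x assume "x \<in> space (marginal X D)" and opt: "(w0 \<circ> f) x \<in> opt_set S c z (fstar x)"
      then have "x \<in> X"
        by (simp add: marginal_def space_restrict_space)
      then show "opt_set S c z (f x) \<inter> opt_set S c z (fstar x) \<noteq> {}"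
        using opt w0(3)[OF HD[OF f(1)]] by auto
    qed
    then show False
      using ident f by blast
  qed
  have risk_modulus: "\<exists>\<delta>>0. \<forall>f\<in>H. \<forall>g\<in>H. sup_dist NK X f g < \<delta> \<longrightarrow>
      \<bar>risk D c (w0 \<circ> f) - risk D c (w0 \<circ> g)\<bar> \<le> \<epsilon>" if "\<epsilon> > 0" for \<epsilon>
  proof -
    obtain \<delta> where \<delta>: "\<delta> > 0" "\<And>f g y. f \<in> H \<Longrightarrow> g \<in> H \<Longrightarrow> sup_dist NK X f g < \<delta> \<Longrightarrow>
        y \<in> space D \<Longrightarrow> \<bar>h f y - h g y\<bar> \<le> \<epsilon>"
      using h_modulus[OF \<open>\<epsilon> > 0\<close>] by blast
    have "\<bar>risk D c (w0 \<circ> f) - risk D c (w0 \<circ> g)\<bar> \<le> \<epsilon>"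
      if fg: "f \<in> H" "g \<in> H" "sup_dist NK X f g < \<delta>" for f g
    proof -
      have "\<bar>risk D c (w0 \<circ> f) - risk D c (w0 \<circ> g)\<bar> = \<bar>\<integral>y. h f y - h g y \<partial>D\<bar>"
        using fg by (simp add: h_int flip: h_risk)
      also have "\<dots> \<le> (\<integral>y. \<bar>h f y - h g y\<bar> \<partial>D)"
        by (rule integral_abs_bound)
      also have "\<dots> \<le> \<epsilon>"
        using fg \<delta>(2)
        by (intro integral_le_const)
           (auto intro!: integrable_abs Bochner_Integration.integrable_diff h_int)
      finally show ?thesis .
    qed
    then show ?thesis
      using \<delta>(1) by blast
  qed
  show "AE \<omega> in M. (\<lambda>n. sup_dist NK X (fhat n \<omega>) fstar) \<longlonglongrightarrow> 0
      \<and> (\<forall>x\<in>X. (\<lambda>n. dist_to N (u (\<rho> n) (fhat n \<omega> x)) (opt_set S c z (fstar x))) \<longlonglongrightarrow> 0)"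
    using unif
  proof (rule AE_mp, intro AE_I2 impI)
    fix \<omega> assume \<omega>: "\<omega> \<in> space M" and close: "\<forall>\<epsilon>>0. \<forall>\<^sub>F n in sequentially. \<forall>f\<in>H.
      \<bar>emp_risk c (\<lambda>i. Z i \<omega>) n (u (\<rho> n) \<circ> f) - risk D c (w0 \<circ> f)\<bar> \<le> \<epsilon>"
    have fhatH: "\<forall>\<^sub>F n in sequentially. fhat n \<omega> \<in> H"
      using ev_fhat[OF \<omega>] by eventually_elim (simp add: is_arg_min_def)
    have lim: "(\<lambda>n. risk D c (w0 \<circ> fhat n \<omega>)) \<longlonglongrightarrow> risk D c (w0 \<circ> fstar)"
      by (rule uniform_convergence_arg_min[OF _ ev_fhat[OF \<omega>] min_w0]) (use close in auto)
    have conv: "(\<lambda>n. sup_dist NK X (fhat n \<omega>) fstar) \<longlonglongrightarrow> 0"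
    proof (rule tendstoI)
      fix \<epsilon> :: real assume "\<epsilon> > 0"
      then obtain \<eta> where \<eta>: "\<eta> > 0" "\<And>f. f \<in> H \<Longrightarrow> \<epsilon> \<le> sup_dist NK X f fstar \<Longrightarrow>
          risk D c (w0 \<circ> fstar) + \<eta> \<le> risk D c (w0 \<circ> f)"
      proof (rule H.unique_minimizer_well_separated[where F = "\<lambda>f. risk D c (w0 \<circ> f)" and \<epsilon> = \<epsilon>,
            OF H(3) fstar(2), rotated 2])
        show "\<exists>\<delta>>0. \<forall>f\<in>H. \<forall>g\<in>H. sup_dist NK X f g < \<delta> \<longrightarrow>
            \<bar>risk D c (w0 \<circ> f) - risk D c (w0 \<circ> g)\<bar> \<le> e" if "e > 0" for e
          by (rule risk_modulus[OF that])
        show "risk D c (w0 \<circ> fstar) < risk D c (w0 \<circ> f)" if "f \<in> H" "f \<noteq> fstar" for f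
          by (rule strict[OF that])
      qed metis
      \<comment> \<open>By the choice of \<eta>, a risk below this threshold forces the distance to
        \<open>fstar\<close> below \<epsilon>.\<close>
      have "\<forall>\<^sub>F n in sequentially. risk D c (w0 \<circ> fhat n \<omega>) < risk D c (w0 \<circ> fstar) + \<eta>"
        using lim \<eta>(1) by (intro order_tendstoD) auto
      then show "\<forall>\<^sub>F n in sequentially. dist (sup_dist NK X (fhat n \<omega>) fstar) 0 < \<epsilon>"
        using fhatH
      proof eventually_elim
        case (elim n)
        then show ?case
          using \<eta>(2)[OF elim(2)] by (cases "\<epsilon> \<le> sup_dist NK X (fhat n \<omega>) fstar") auto
      qed
    qed
    have "(\<lambda>n. dist_to N (u (\<rho> n) (fhat n \<omega> x)) (opt_set S c z (fstar x))) \<longlonglongrightarrow> 0" if x: "x \<in> X" for x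
    proof (rule tendsto_sandwich[OF _ _ tendsto_const])
      \<comment> \<open>The distance to the optimal set is at most that to its element
        \<open>w0 (fstar x)\<close>. The first summand bounds the regularization error, the second
        the error of the hypothesis.\<close>
      let ?b = "\<lambda>n. BN * (A * \<rho> n + L * (bK * sup_dist NK X (fhat n \<omega>) fstar))"
      have opt: "w0 (fstar x) \<in> opt_set S c z (fstar x)"
        by (intro w0 HD fstar x)
      show "\<forall>\<^sub>F n in sequentially. 0 \<le> dist_to N (u (\<rho> n) (fhat n \<omega> x)) (opt_set S c z (fstar x))"
        unfolding dist_to_def using opt N0 by (intro always_eventually allI cINF_greatest) auto
      \<comment> \<open>The instance 1 is arbitrary: only the range of \<open>\<rho> n\<close> is
        taken from \<open>ev_\<rho>\<close> here.\<close>
      show "\<forall>\<^sub>F n in sequentially. dist_to N (u (\<rho> n) (fhat n \<omega> x)) (opt_set S c z (fstar x)) \<le> ?b n"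
        using fhatH ev_\<rho>[of 1, simplified]
      proof eventually_elim
        case (elim n)
        let ?v = "u (\<rho> n) (fhat n \<omega> x)"
        have "dist_to N ?v (opt_set S c z (fstar x)) \<le> N (?v - w0 (fstar x))"
          unfolding dist_to_def by (rule cINF_lower[OF _ opt]) (use N0 in \<open>auto intro!: bdd_belowI\<close>)
        also have "\<dots> \<le> BN * norm (?v - w0 (fstar x))"
          by (rule BN)
        also have "norm (?v - w0 (fstar x)) \<le>
            norm (?v - w0 (fhat n \<omega> x)) + norm (w0 (fhat n \<omega> x) - w0 (fstar x))"
          using norm_triangle_ineq[of "?v - w0 (fhat n \<omega> x)" "w0 (fhat n \<omega> x) - w0 (fstar x)"] by simp
        also have "\<dots> \<le> A * \<rho> n + L * norm (fhat n \<omega> x - fstar x)"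
          using elim x fstar(2) by (intro add_mono w0 HD) auto
        also have "\<dots> \<le> A * \<rho> n + L * (bK * sup_dist NK X (fhat n \<omega>) fstar)"
          using elim x fstar(2) L0 by (intro add_left_mono mult_left_mono sup_dist)
        finally show ?case
          using BN(1) by simp
      qed
      show "?b \<longlonglongrightarrow> 0"
        by (auto intro!: tendsto_eq_intros \<rho>(3) conv)
    qed
    with conv show "(\<lambda>n. sup_dist NK X (fhat n \<omega>) fstar) \<longlonglongrightarrow> 0 \<and>
      (\<forall>x\<in>X. (\<lambda>n. dist_to N (u (\<rho> n) (fhat n \<omega> x)) (opt_set S c z (fstar x))) \<longlonglongrightarrow> 0)"
      by blast
  qed
qed

section \<open>Almost sure convergence of risks, decisions and hypotheses\<close>

theorem theorem1:
  fixes S :: "(real ^ 'd) set"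
    and N :: "real ^ 'd \<Rightarrow> real"
    and NK NL :: "real ^ 'k \<Rightarrow> real"
    and X :: "(real ^ 'p) set"
    and z :: "'k \<Rightarrow> 'z"
    and c :: "real ^ 'd \<Rightarrow> 'z \<Rightarrow> real"
    and \<phi> :: "real ^ 'd \<Rightarrow> real"
    and D :: "((real ^ 'p) \<times> 'z) measure"
    and H :: "(real ^ 'p \<Rightarrow> real ^ 'k) set"
    and w :: "real ^ 'k \<Rightarrow> real ^ 'd"
    and fstar :: "real ^ 'p \<Rightarrow> real ^ 'k"
    and fstar\<rho> :: "real \<Rightarrow> real ^ 'p \<Rightarrow> real ^ 'k"
    and M :: "'a measure"
    and Z :: "nat \<Rightarrow> 'a \<Rightarrow> (real ^ 'p) \<times> 'z"
    and fhat :: "nat \<Rightarrow> 'a \<Rightarrow> real ^ 'p \<Rightarrow> real ^ 'k"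
    and \<rho> :: "nat \<Rightarrow> real"
    and \<rho>0 L\<rho> Lw :: real
  assumes S: "S \<noteq> {}" "convex S" "compact S"
    and norms: "is_norm N" "is_norm NK" "is_norm NL"
    and z: "inj z"
    and c: "\<forall>k. convex_on S (\<lambda>v. c v (z k))" "\<forall>k. continuous_on S (\<lambda>v. c v (z k))"
    and \<phi>: "\<forall>v\<in>S. 0 \<le> \<phi> v" "continuous_on S \<phi>" "strongly_convex_on N S \<phi>"
    and D: "prob_space D" "sets D = sets (restrict_space borel X \<Otimes>\<^sub>M count_space (range z))"
    and H: "H \<subseteq> X \<rightarrow>\<^sub>E prob_simplex"
      "\<forall>f\<in>H. f \<in> borel_measurable (restrict_space borel X)"
      "compact_space (Metric_space.mtopology H (sup_dist NK X))"
    and fstar: "true_hypothesis X D z fstar"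
    and w: "\<forall>p\<in>prob_simplex. w p \<in> opt_set S c z p"
      "\<forall>f\<in>H. w \<circ> f \<in> borel_measurable (restrict_space borel X)"
    and fstar\<rho>: "\<forall>r>0. is_arg_min (\<lambda>f. risk D c (reg_opt S c z \<phi> r \<circ> f)) (\<lambda>f. f \<in> H) (fstar\<rho> r)"
    and sample: "prob_space M"
      "prob_space.indep_vars M (\<lambda>_. D) Z {1..}"
      "\<forall>i\<ge>1. distr M D (Z i) = D"
    and \<rho>: "\<rho>0 > 0" "\<forall>n\<ge>1. \<rho> n \<in> {0<..\<rho>0}" "\<rho> \<longlonglongrightarrow> 0"
    and fhat: "\<forall>n\<ge>1. \<forall>\<omega>\<in>space M.
      is_arg_min (\<lambda>f. emp_risk c (\<lambda>i. Z i \<omega>) n (reg_opt S c z \<phi> (\<rho> n) \<circ> f))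
        (\<lambda>f. f \<in> H) (fhat n \<omega>)"
    and A1A: "fstar \<in> H"
    and A1B: "\<forall>\<epsilon>\<in>{0<..<1}. bracketing_number NK X \<epsilon> H < \<infinity>"
    and A2A: "\<forall>p\<in>prob_simplex. \<forall>r1\<in>{0<..\<rho>0}. \<forall>r2\<in>{0<..\<rho>0}.
      N (reg_opt S c z \<phi> r1 p - reg_opt S c z \<phi> r2 p) \<le> L\<rho> * \<bar>r1 - r2\<bar>"
    and A2B: "\<forall>r\<in>{0<..\<rho>0}. \<forall>p1\<in>prob_simplex. \<forall>p2\<in>prob_simplex.
      N (reg_opt S c z \<phi> r p1 - reg_opt S c z \<phi> r p2) \<le> Lw * NL (p1 - p2)"
  shows "(AE \<omega> in M.
        (\<lambda>n. min_over (\<lambda>f. emp_risk c (\<lambda>i. Z i \<omega>) n (reg_opt S c z \<phi> (\<rho> n) \<circ> f)) H)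
          \<longlonglongrightarrow> min_over (\<lambda>f. risk D c (w \<circ> f)) H) \<and>
    (identifiable S N c z \<phi> X D H fstar fstar\<rho> \<and>
     separated_risk S N c z \<phi> X D H fstar\<rho> \<rho>0 \<longrightarrow>
      (AE x in marginal X D. AE \<omega> in M.
        (\<lambda>n. dist_to N (reg_opt S c z \<phi> (\<rho> n) (fhat n \<omega> x)) (opt_set S c z (fstar x)))
          \<longlonglongrightarrow> 0)) \<and>
    (identifiable S N c z \<phi> X D H fstar fstar\<rho> \<and>
     separated_risk S N c z \<phi> X D H fstar\<rho> \<rho>0 \<longrightarrow>
      (AE \<omega> in M. (\<lambda>n. sup_dist NK X (fhat n \<omega>) fstar) \<longlonglongrightarrow> 0))"
proof -
  interpret finite_scenarios X D z
    using D z by (simp add: finite_scenarios_def finite_scenarios_axioms_def)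
  note consistency = regularized_erm_consistency[where S = S and N = N and NK = NK and NL = NL
      and c = c and \<phi> = \<phi> and H = H and fstar = fstar and w = w and M = M and Z = Z and \<rho> = \<rho>
      and \<rho>max = \<rho>0 and fhat = fhat and L\<rho> = L\<rho> and Lw = Lw]
  have conv: "AE \<omega> in M. (\<lambda>n. sup_dist NK X (fhat n \<omega>) fstar) \<longlonglongrightarrow> 0
      \<and> (\<forall>x\<in>X. (\<lambda>n. dist_to N (reg_opt S c z \<phi> (\<rho> n) (fhat n \<omega> x)) (opt_set S c z (fstar x)))
        \<longlonglongrightarrow> 0)"
    if "identifiable S N c z \<phi> X D H fstar fstar\<rho>"
  proof (rule consistency(2))
    show "f = fstar" if "f \<in> H"
      "AE x in marginal X D. opt_set S c z (f x) \<inter> opt_set S c z (fstar x) \<noteq> {}" for f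
      using \<open>identifiable S N c z \<phi> X D H fstar fstar\<rho>\<close> that by (auto simp: identifiable_def)
  qed (use assms in \<open>simp_all\<close>)
  show ?thesis
  proof (intro conjI impI; (elim conjE)?)
    show "AE \<omega> in M.
        (\<lambda>n. min_over (\<lambda>f. emp_risk c (\<lambda>i. Z i \<omega>) n (reg_opt S c z \<phi> (\<rho> n) \<circ> f)) H)
          \<longlonglongrightarrow> min_over (\<lambda>f. risk D c (w \<circ> f)) H"
      by (rule consistency(1)) (use assms in simp_all)
    assume ident: "identifiable S N c z \<phi> X D H fstar fstar\<rho>"
    show "AE \<omega> in M. (\<lambda>n. sup_dist NK X (fhat n \<omega>) fstar) \<longlonglongrightarrow> 0"
      using conv[OF ident] by eventually_elim blast
    show "AE x in marginal X D. AE \<omega> in M.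
        (\<lambda>n. dist_to N (reg_opt S c z \<phi> (\<rho> n) (fhat n \<omega> x)) (opt_set S c z (fstar x))) \<longlonglongrightarrow> 0"
    \<comment> \<open>The event in \<open>conv\<close> does not depend on the feature, so the claim
      holds at every \<open>x\<close> in \<open>X\<close> and in particular almost
      everywhere.\<close>
    proof (rule AE_I2)
      fix x assume "x \<in> space (marginal X D)"
      then have x: "x \<in> X"
        by (simp add: marginal_def space_restrict_space)
      from conv[OF ident] show "AE \<omega> in M.
          (\<lambda>n. dist_to N (reg_opt S c z \<phi> (\<rho> n) (fhat n \<omega> x)) (opt_set S c z (fstar x))) \<longlonglongrightarrow> 0"
        by eventually_elim (use x in blast)
    qed
  qed
qed

end
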